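(* Fix $k\in\mathbb N$. Suppose the fine structure assumption, the coarse structure assumption and the nonsmooth primal-dual coherence condition stated in the context hold for the initial coarse iterate $v^{k,0}=I_h^Hu_+^k$, and that $v^{k,0}$ does not solve the coarse problem. Let $\kappa\in(0,1)$, $\varepsilon_k,\rho_k>0$, let $d^k$ be the coarse correction direction, and let $\theta>0$ satisfy $$\Phi^k(u_+^k+\theta d^k)+\frac12\|\theta d^k\|_M^2+\frac1{2\varepsilon_k}\|\theta d^k\|_W^2\le\Phi^k(u_+^k)+\kappa\theta[\Phi^k]'(u_+^k;d^k)+\frac{\rho_k}2.$$ Then, for all $\hat u\in U$, $$\mathcal G_L(u_+^k+\theta d^k;\hat u)+\frac12\|u_+^k+\theta d^k-\hat u\|_M^2+\frac12\|u_+^k-u^k\|_{M-\Lambda}^2\le\frac12\|u^k-\hat u\|_M^2+\frac{\varepsilon_k}2\|u_+^k-\hat u\|_M^2+\frac{\rho_k}2.$$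
   Context: $\mathbb L(A;B)$ denotes the bounded linear operators from $A$ to $B$; $\overline{\mathbb R}=[-\infty,+\infty]$; $\partial$ is the convex subdifferential, $(\cdot)^*$ on functions is the Fenchel conjugate and on operators the adjoint; $f'(u;d)$ is the (one-sided) directional derivative; $\|u\|_A:=\sqrt{\langle Au,u\rangle}$ for self-adjoint positive semi-definite $A$. Fine structure assumption: $X,Y$ are Hilbert spaces, $U=X\times Y$; $F,E:X\to\overline{\mathbb R}$ and $G:Y\to\overline{\mathbb R}$ are proper, convex and lower semicontinuous, $E$ is differentiable on $X$ with $L$-Lipschitz gradient, $K\in\mathbb L(X;Y)$, and $\tau,\sigma>0$ satisfy $\tau L+\tau\sigma\|K\|^2<1$. For $u=(x,y)\in U$: $\bar G(u):=F(x)+G^*(y)$, $\bar E(u):=E(x)$, $$M=\begin{pmatrix}\tau^{-1}\mathrm{Id}&-K^*\\-K&\sigma^{-1}\mathrm{Id}\end{pmatrix},\ \Xi=\begin{pmatrix}0&K^*\\-K&0\end{pmatrix},\ \Lambda=\begin{pmatrix}L\,\mathrm{Id}&0\\0&0\end{pmatrix},\ Z=\begin{pmatrix}\tau^{-1}\mathrm{Id}&-2K^*\\0&\sigma^{-1}\mathrm{Id}\end{pmatrix},\ W=\frac1CZZ^*,$$ with $C:=(1-\sqrt{\tau\sigma}\|K\|)\min\{\tau^{-1},\sigma^{-1}\}>0$. Let $\Phi(u;\hat u):=\bar G(u)+\bar E(u)+\langle\Xi\hat u,u\rangle$; the Lagrangian gap is $\mathcal G_L(u;\hat u):=\Phi(u;\hat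 u)-\Phi(\hat u;\hat u)$. Fine pre-iterate: given $u^k=(x^k,y^k)\in U$, $u_+^k=(x_+^k,y_+^k)$ with $x_+^k:=\mathrm{prox}_{\tau F}(x^k-\tau(\nabla E(x^k)+K^*y^k))$, $y_+^k:=\mathrm{prox}_{\sigma G^*}(y^k+\sigma K(2x_+^k-x^k))$. Set $\Phi^k(u):=\Phi(u;u_+^k)$. Transfer operators: $X_H,Y_H$ are Hilbert spaces, $U_H=X_H\times Y_H$ with elements $v=(\zeta,\xi)$; $P_h^H\in\mathbb L(X;X_H)$, $D_h^H\in\mathbb L(Y;Y_H)$, $I_h^H(x,y):=(P_h^Hx,D_h^Hy)$, $I_H^h:=(I_h^H)^*$. Coarse structure assumption: $E_H:X_H\to\mathbb R$, $F_H^k:X_H\to\overline{\mathbb R}$, $G_H^k:Y_H\to\overline{\mathbb R}$ are proper, convex and lower semicontinuous, $E_H$ is differentiable with $L_H$-Lipschitz gradient, $K_H\in\mathbb L(X_H;Y_H)$, and $\tau_H,\sigma_H>0$ satisfy $\tau_HL_H+\tau_H\sigma_H\|K_H\|^2<1$. Write $\bar G_H^k(v):=F_H^k(\zeta)+(G_H^k)^*(\xi)$, $\bar E_H(v):=E_H(\zeta)$, $$M_H=\begin{pmatrix}\tau_H^{-1}\mathrm{Id}&-K_H^*\\-K_H&\sigma_H^{-1}\mathrm{Id}\end{pmatrix},\quad \Xi_H=\begin{pmatrix}0&K_H^*\\-K_H&0\end{pmatrix}.$$ Coherence condition: $I_h^H\partial\bar G(u_+^k)\subset\partial\bar G_H^k(v^{k,0})$.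 Coarse problem: with $s_H^k:=I_h^H(\nabla\bar E(u_+^k)+\Xi u_+^k)-\nabla\bar E_H(v^{k,0})$ and $(r_H^k,o_H^k)=w_H^k:=s_H^k-\Xi_Hv^{k,0}$, the problem is $\min_{\zeta}\max_{\xi}F_H^k(\zeta)+E_H(\zeta)+\langle\xi,K_H\zeta\rangle-(G_H^k)^*(\xi)+\langle r_H^k,\zeta\rangle-\langle o_H^k,\xi\rangle$; $v$ solves it if it is a saddle point, i.e. $0\in\partial\bar G_H^k(v)+\nabla\bar E_H(v)+\Xi_Hv+w_H^k$. Coarse direction: let $m\ge1$ and $\vartheta\in\{0,1\}$; for $j=0,\ldots,m-1$, $v^{k,j+1}$ is determined by $$0\in\partial\bar G_H^k(v^{k,j+1})+\Xi_H(v^{k,j+1}-v_\vartheta^j)+\nabla\bar E_H(v^{k,j})+s_H^k+M_H(v^{k,j+1}-v^{k,j}),\quad v_\vartheta^j:=(1-\vartheta)v^{k,j}+\vartheta v^{k,0}.$$ Let $\tilde v^{k,m}:=\frac1m\sum_{j=0}^{m-1}v^{k,j+1}$ if $\vartheta=1$, $\tilde v^{k,m}:=v^{k,m}$ if $\vartheta=0$, and $d^k:=I_H^h(\tilde v^{k,m}-v^{k,0})$.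
   Formalization: The formal theorem also assumes the max formula at the point and direction used: [Φ^k]'(u_+^k; d^k) equals the supremum of ⟨p, d^k⟩ over p in ∂Φ^k(u_+^k). Without it the claim can fail when u_+^k lies on the boundary of the domain; it is automatic where Φ^k is continuous. *)

theory Defs
  imports "HOL-Analysis.Analysis"
begin

section \<open>Convex analysis of extended-real-valued functions\<close>

definition proper :: "('a \<Rightarrow> ereal) \<Rightarrow> bool" where
  "proper f \<longleftrightarrow> (\<exists>x. f x \<noteq> \<infinity>) \<and> (\<forall>x. f x \<noteq> -\<infinity>)"

(* Only used together with proper, so no sum of opposite infinities occurs. *)
definition convex_fun :: "('a::real_vector \<Rightarrow> ereal) \<Rightarrow> bool" where
  "convex_fun f \<longleftrightarrow> (\<forall>x y t. 0 < t \<and> t < 1 \<longrightarrow>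
     f ((1 - t) *\<^sub>R x + t *\<^sub>R y) \<le> ereal (1 - t) * f x + ereal t * f y)"

definition lsc :: "('a::topological_space \<Rightarrow> ereal) \<Rightarrow> bool" where
  "lsc f \<longleftrightarrow> (\<forall>x. f x \<le> Liminf (at x) f)"

definition proper_convex_lsc :: "('a::real_normed_vector \<Rightarrow> ereal) \<Rightarrow> bool" where
  "proper_convex_lsc f \<longleftrightarrow> proper f \<and> convex_fun f \<and> lsc f"

definition subdiff :: "('a::real_inner \<Rightarrow> ereal) \<Rightarrow> 'a \<Rightarrow> 'a set" where
  "subdiff f x = {p. \<bar>f x\<bar> \<noteq> \<infinity> \<and> (\<forall>z. f x + ereal (p \<bullet> (z - x)) \<le> f z)}"

definition conjugate :: "('a::real_inner \<Rightarrow> ereal) \<Rightarrow> 'a \<Rightarrow> ereal" where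
  "conjugate f p = (SUP x. ereal (p \<bullet> x) - f x)"

definition prox :: "('a::real_inner \<Rightarrow> ereal) \<Rightarrow> 'a \<Rightarrow> 'a" where
  "prox f z = (ARG_MIN (\<lambda>u. f u + ereal ((norm (u - z))\<^sup>2 / 2)) u. True)"

(* The one-sided directional derivative at a point where f is finite; for convex f the
   limit always exists in the extended reals.  Pitfall: if f is not continuous at u, the
   derivative may be strictly larger than the supremum of p \<bullet> d over p in subdiff f u;
   it may be positive or infinite while that supremum is negative.  Results that rest on
   the max formula (derivative = supremum) therefore have to assume it. *)
definition dirderiv :: "('a::real_vector \<Rightarrow> ereal) \<Rightarrow> 'a \<Rightarrow> 'a \<Rightarrow> ereal" where
  "dirderiv f u d = Lim (at_right 0) (\<lambda>t::real. (f (u + t *\<^sub>R d) - f u) / ereal t)"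

definition differentiable_fun :: "('a::real_normed_vector \<Rightarrow> ereal) \<Rightarrow> bool" where
  "differentiable_fun f \<longleftrightarrow>
     (\<forall>x. \<bar>f x\<bar> \<noteq> \<infinity> \<and> (\<lambda>z. real_of_ereal (f z)) differentiable (at x))"

definition gradient :: "('a::real_inner \<Rightarrow> ereal) \<Rightarrow> 'a \<Rightarrow> 'a" where
  "gradient f x = (THE g. GDERIV (\<lambda>z. real_of_ereal (f z)) x :> g)"

definition opnorm :: "('a::real_inner \<Rightarrow> 'a) \<Rightarrow> 'a \<Rightarrow> real" where
  "opnorm A u = sqrt (A u \<bullet> u)"


section \<open>Primal-dual structure\<close>

(* norm K is the operator norm; the product type 'x \<times> 'y carries the Hilbert space
   structure (x, y) \<bullet> (x', y') = x \<bullet> x' + y \<bullet> y'. *)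
definition pd_structure ::
  "('x::{real_inner,complete_space} \<Rightarrow> ereal) \<Rightarrow> ('x \<Rightarrow> ereal) \<Rightarrow>
   ('y::{real_inner,complete_space} \<Rightarrow> ereal) \<Rightarrow> ('x \<Rightarrow>\<^sub>L 'y) \<Rightarrow>
   real \<Rightarrow> real \<Rightarrow> real \<Rightarrow> bool" where
  "pd_structure F E G K L \<tau> \<sigma> \<longleftrightarrow>
     proper_convex_lsc F \<and> proper_convex_lsc E \<and> proper_convex_lsc G \<and>
     differentiable_fun E \<and> L-lipschitz_on UNIV (gradient E) \<and>
     \<tau> > 0 \<and> \<sigma> > 0 \<and> \<tau> * L + \<tau> * \<sigma> * (norm K)\<^sup>2 < 1"

definition Gbar :: "('x \<Rightarrow> ereal) \<Rightarrow> ('y::real_inner \<Rightarrow> ereal) \<Rightarrow> 'x \<times> 'y \<Rightarrow> ereal" where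
  "Gbar F G u = F (fst u) + conjugate G (snd u)"

definition Ebar :: "('x \<Rightarrow> ereal) \<Rightarrow> 'x \<times> 'y \<Rightarrow> ereal" where
  "Ebar E u = E (fst u)"

definition M_op :: "real \<Rightarrow> real \<Rightarrow> ('x::real_inner \<Rightarrow>\<^sub>L 'y::real_inner) \<Rightarrow> 'x \<times> 'y \<Rightarrow> 'x \<times> 'y" where
  "M_op \<tau> \<sigma> K u =
     ((1 / \<tau>) *\<^sub>R fst u - adjoint (blinfun_apply K) (snd u),
      - blinfun_apply K (fst u) + (1 / \<sigma>) *\<^sub>R snd u)"

definition Xi_op :: "('x::real_inner \<Rightarrow>\<^sub>L 'y::real_inner) \<Rightarrow> 'x \<times> 'y \<Rightarrow> 'x \<times> 'y" where
  "Xi_op K u = (adjoint (blinfun_apply K) (snd u), - blinfun_apply K (fst u))"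

definition Lambda_op :: "real \<Rightarrow> 'x::real_inner \<times> 'y::real_inner \<Rightarrow> 'x \<times> 'y" where
  "Lambda_op L u = (L *\<^sub>R fst u, 0)"

definition Z_op :: "real \<Rightarrow> real \<Rightarrow> ('x::real_inner \<Rightarrow>\<^sub>L 'y::real_inner) \<Rightarrow> 'x \<times> 'y \<Rightarrow> 'x \<times> 'y" where
  "Z_op \<tau> \<sigma> K u =
     ((1 / \<tau>) *\<^sub>R fst u - 2 *\<^sub>R adjoint (blinfun_apply K) (snd u), (1 / \<sigma>) *\<^sub>R snd u)"

definition C_const :: "real \<Rightarrow> real \<Rightarrow> ('x::real_inner \<Rightarrow>\<^sub>L 'y::real_inner) \<Rightarrow> real" where
  "C_const \<tau> \<sigma> K = (1 - sqrt (\<tau> * \<sigma>) * norm K) * min (1 / \<tau>) (1 / \<sigma>)"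

definition W_op :: "real \<Rightarrow> real \<Rightarrow> ('x::real_inner \<Rightarrow>\<^sub>L 'y::real_inner) \<Rightarrow> 'x \<times> 'y \<Rightarrow> 'x \<times> 'y" where
  "W_op \<tau> \<sigma> K u = (1 / C_const \<tau> \<sigma> K) *\<^sub>R Z_op \<tau> \<sigma> K (adjoint (Z_op \<tau> \<sigma> K) u)"

definition Phi ::
  "('x::real_inner \<Rightarrow> ereal) \<Rightarrow> ('x \<Rightarrow> ereal) \<Rightarrow> ('y::real_inner \<Rightarrow> ereal) \<Rightarrow> ('x \<Rightarrow>\<^sub>L 'y) \<Rightarrow>
   'x \<times> 'y \<Rightarrow> 'x \<times> 'y \<Rightarrow> ereal" where
  "Phi F E G K u uh = Gbar F G u + Ebar E u + ereal (Xi_op K uh \<bullet> u)"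

definition lagrangian_gap ::
  "('x::real_inner \<Rightarrow> ereal) \<Rightarrow> ('x \<Rightarrow> ereal) \<Rightarrow> ('y::real_inner \<Rightarrow> ereal) \<Rightarrow> ('x \<Rightarrow>\<^sub>L 'y) \<Rightarrow>
   'x \<times> 'y \<Rightarrow> 'x \<times> 'y \<Rightarrow> ereal" where
  "lagrangian_gap F E G K u uh = Phi F E G K u uh - Phi F E G K uh uh"

definition restrict_op ::
  "('x::real_normed_vector \<Rightarrow>\<^sub>L 'xh::real_normed_vector) \<Rightarrow>
   ('y::real_normed_vector \<Rightarrow>\<^sub>L 'yh::real_normed_vector) \<Rightarrow> 'x \<times> 'y \<Rightarrow> 'xh \<times> 'yh" where
  "restrict_op P D u = (blinfun_apply P (fst u), blinfun_apply D (snd u))"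

(* v is a saddle point of
   F(\<zeta>) + E(\<zeta>) + \<xi> \<bullet> K \<zeta> - G*(\<xi>) + r \<bullet> \<zeta> - o \<bullet> \<xi>   for w = (r, o),
   expressed by the inclusion 0 \<in> subdiff Gbar(v) + gradient Ebar(v) + Xi v + w. *)
definition solves_coarse ::
  "('x::real_inner \<Rightarrow> ereal) \<Rightarrow> ('x \<Rightarrow> ereal) \<Rightarrow> ('y::real_inner \<Rightarrow> ereal) \<Rightarrow> ('x \<Rightarrow>\<^sub>L 'y) \<Rightarrow>
   'x \<times> 'y \<Rightarrow> 'x \<times> 'y \<Rightarrow> bool" where
  "solves_coarse F E G K w v \<longleftrightarrow>
     0 \<in> (\<lambda>p. p + gradient (Ebar E) v + Xi_op K v + w) ` subdiff (Gbar F G) v"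

end

theory Submission
  imports Defs
begin

text \<open>
  The estimate splits into a statement about the pre-iterate \<open>a = u\<^sub>p\<close> and one about the
  correction \<open>b = \<theta> d\<close>.

  The pre-iterate is a preconditioned forward-backward step:
  \<open>0 \<in> \<partial>Gbar a + \<nabla>Ebar u\<^sub>k + \<Xi> a + M (a - u\<^sub>k)\<close>.  Convexity of \<open>Gbar\<close> and \<open>E\<close>, the descent lemma
  for \<open>E\<close> and the three-point identity for \<open>M\<close> turn this inclusion into the claimed
  inequality with \<open>b = 0\<close>, \<open>\<epsilon> = 0\<close>, \<open>\<rho> = 0\<close> (\<open>pd_step_inequality\<close>).

  Adding \<open>b\<close> changes the left-hand side by
  \<open>\<Phi>(a + b; a) - \<Phi>(a; a) + (M/2) b \<bullet> b + (M - \<Xi>) (a - uh) \<bullet> b\<close>, and \<open>M - \<Xi>\<close> is exactly the operator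
  \<open>Z\<close>.  As \<open>M\<close> dominates \<open>C Id\<close> and \<open>W = Z Z* / C\<close>, Young's inequality bounds the cross term by
  \<open>(\<epsilon>/2) \<parallel>a - uh\<parallel>\<^sub>M\<^sup>2 + \<parallel>b\<parallel>\<^sub>W\<^sup>2 / (2 \<epsilon>)\<close> (\<open>Z_young\<close>).  The first of these terms appears in the
  claim, and the second is absorbed by the line search condition once its slope term is known to
  be at most zero (\<open>gap_estimate_of_line_search\<close>).

  The slope is nonpositive because of coherence.  By the max formula it is the supremum of \<open>p \<bullet> d\<close>
  over the subgradients \<open>p\<close> of \<open>\<Phi>(\<cdot>; a)\<close> at \<open>a\<close>.  Restriction maps each of them
  to a subgradient at \<open>v 0\<close> of the coarse function
  \<open>\<Psi> = Gbar\<^sub>H + Ebar\<^sub>H + s \<bullet> (\<cdot>)\<close>, so the pairing with \<open>d\<close> is at most \<open>\<Psi>(vt) - \<Psi>(v 0)\<close>, or, if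
  \<open>vt\<close> is the ergodic average, at most the average of such differences over the coarse iterates.  The
  same step inequality shows that this bound is at most zero (\<open>coarse_direction_nonascent\<close>).

  In a general Hilbert space the adjoints, gradients and proximal points have to be shown to
  exist.  All three come from one minimisation: a proper convex lower semicontinuous
  function plus a squared distance attains its minimum (\<open>prox_is_arg_min\<close>), and for a bounded
  linear function the minimiser is its Riesz representative up to sign.
\<close>

section \<open>Proximal points in Hilbert space\<close>

lemma proper_realE:
  assumes "proper f" obtains "f x = \<infinity>" | r where "f x = ereal r"
  using assms by (cases "f x") (auto simp: proper_def)

lemma convex_fun_ereal:
  assumes "convex_fun f" "0 < t" "t < 1" "f x \<le> ereal a" "f y \<le> ereal b"
  shows "f ((1 - t) *\<^sub>R x + t *\<^sub>R y) \<le> ereal ((1 - t) * a + t * b)"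
proof -
  have "f ((1 - t) *\<^sub>R x + t *\<^sub>R y) \<le> ereal (1 - t) * f x + ereal t * f y"
    using assms by (auto simp: convex_fun_def)
  also have "\<dots> \<le> ereal (1 - t) * ereal a + ereal t * ereal b"
    using assms by (intro add_mono ereal_mult_left_mono) auto
  finally show ?thesis by simp
qed

lemma lsc_eventually_nhds:
  assumes "lsc f" "c < f x"
  shows "\<forall>\<^sub>F z in nhds x. c < f z"
  using assms by (auto simp: lsc_def le_Liminf_iff eventually_nhds_conv_at)

text \<open>
  A convex function decays at most linearly: near a point \<open>x0\<close> where \<open>f\<close> is finite, lower
  semicontinuity keeps \<open>f\<close> above \<open>f x0 - 1\<close>, and convexity along the ray from \<open>x0\<close> to \<open>u\<close>
  transports this bound to any distance.  This gives the coercivity of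
  \<open>f + \<parallel>\<cdot> - z\<parallel>\<^sup>2 / 2\<close> without a separation theorem.
\<close>

lemma proper_convex_lsc_lower_bound:
  fixes f :: "'a::real_normed_vector \<Rightarrow> ereal"
  assumes "proper_convex_lsc f"
  obtains x0 b c where "0 \<le> b" "\<And>u. ereal (c - b * norm (u - x0)) \<le> f u"
proof -
  have pr: "proper f" and cv: "convex_fun f" and ls: "lsc f"
    using assms by (auto simp: proper_convex_lsc_def)
  obtain x0 r where r: "f x0 = ereal r"
    using pr by (metis proper_def proper_realE)
  have "ereal (r - 1) < f x0" using r by simp
  from lsc_eventually_nhds[OF ls this]
  obtain \<delta> where \<delta>: "\<delta> > 0" "\<And>z. dist z x0 < \<delta> \<Longrightarrow> ereal (r - 1) < f z"
    by (auto simp: eventually_nhds_metric)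
  have "ereal ((r - 1) - (2 / \<delta>) * norm (u - x0)) \<le> f u" for u
  proof (cases "norm (u - x0) < \<delta>")
    case True
    have "ereal ((r - 1) - (2 / \<delta>) * norm (u - x0)) \<le> ereal (r - 1)" using \<delta>(1) by simp
    also have "\<dots> \<le> f u" using \<delta>(2)[of u] True by (simp add: dist_norm)
    finally show ?thesis .
  next
    case False
    show ?thesis
    proof (rule proper_realE[OF pr, of u])
      fix q assume q: "f u = ereal q"
      define n where "n = norm (u - x0)"
      have n: "n \<ge> \<delta>" "n > 0" using False \<delta>(1) by (auto simp: n_def)
      \<comment> \<open>the point at distance \<open>\<delta> / 2\<close> from \<open>x0\<close> in the direction of \<open>u\<close>\<close>
      define t where "t = \<delta> / (2 * n)"
      have t: "0 < t" "t < 1" using n \<delta>(1) by (auto simp: t_def field_simps)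
      let ?z = "(1 - t) *\<^sub>R x0 + t *\<^sub>R u"
      have "?z - x0 = t *\<^sub>R (u - x0)" by (simp add: algebra_simps)
      hence "norm (?z - x0) = t * n" using t by (simp add: n_def)
      also have "\<dots> < \<delta>" using n \<delta>(1) by (simp add: t_def)
      finally have "ereal (r - 1) < f ?z" using \<delta>(2) by (simp add: dist_norm)
      also have "f ?z \<le> ereal ((1 - t) * r + t * q)"
        using convex_fun_ereal[OF cv t, of x0 r u q] r q by simp
      finally have "r - 1 < (1 - t) * r + t * q" by simp
      hence "t * r - 1 < t * q" by (simp add: algebra_simps)
      hence "r - 1 / t < q" using t by (simp add: field_simps)
      moreover have "1 / t = (2 / \<delta>) * n" using n \<delta>(1) by (simp add: t_def)
      ultimately show ?thesis using q by (simp add: n_def)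
    qed simp
  qed
  moreover have "0 \<le> 2 / \<delta>" using \<delta>(1) by simp
  ultimately show ?thesis by (rule that[rotated])
qed

text \<open>
  The direct method: the infimum is finite by the linear lower bound, and by the parallelogram
  identity the value at the midpoint of two almost-minimisers is below their mean by an eighth of
  their squared distance.  Hence minimising sequences are Cauchy, and lower semicontinuity passes
  the bound to the limit.
\<close>

lemma prox_is_arg_min:
  fixes f :: "'a::{real_inner,complete_space} \<Rightarrow> ereal"
  assumes "proper_convex_lsc f"
  shows "is_arg_min (\<lambda>u. f u + ereal ((norm (u - z))\<^sup>2 / 2)) (\<lambda>_. True) (prox f z)"
proof -
  have pr: "proper f" and cv: "convex_fun f" and ls: "lsc f"
    using assms by (auto simp: proper_convex_lsc_def)
  let ?h = "\<lambda>u. f u + ereal ((norm (u - z))\<^sup>2 / 2)"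
  define I where "I = (INF u. ?h u)"
  obtain x0 r where r: "f x0 = ereal r"
    using pr by (metis proper_def proper_realE)
  obtain x1 b c where b: "0 \<le> b" and lb: "\<And>u. ereal (c - b * norm (u - x1)) \<le> f u"
    by (rule proper_convex_lsc_lower_bound[OF assms]) blast
  have "ereal (c - b * norm (z - x1) - b\<^sup>2 / 2) \<le> ?h u" for u
  proof -
    have "norm (u - x1) \<le> norm (u - z) + norm (z - x1)"
      by (metis dist_norm dist_triangle)
    from mult_left_mono[OF this b]
    have "b * norm (u - x1) \<le> b * norm (u - z) + b * norm (z - x1)" by (simp add: distrib_left)
    moreover have "0 \<le> (norm (u - z) - b)\<^sup>2" by simp
    ultimately have "c - b * norm (z - x1) - b\<^sup>2 / 2 \<le> (c - b * norm (u - x1)) + (norm (u - z))\<^sup>2 / 2"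
      by (simp add: power2_eq_square algebra_simps)
    hence "ereal (c - b * norm (z - x1) - b\<^sup>2 / 2) \<le> ereal (c - b * norm (u - x1)) + ereal ((norm (u - z))\<^sup>2 / 2)"
      by simp
    also have "\<dots> \<le> ?h u" using lb by (intro add_mono) auto
    finally show ?thesis .
  qed
  hence "ereal (c - b * norm (z - x1) - b\<^sup>2 / 2) \<le> I" by (auto simp: I_def intro: INF_greatest)
  moreover have "I \<le> ereal (r + (norm (x0 - z))\<^sup>2 / 2)" unfolding I_def
    using r by (intro INF_lower2[of x0]) auto
  ultimately obtain i where i: "I = ereal i" by (cases I) auto
  have "\<exists>u. ?h u < ereal (i + 1 / real (Suc n))" for n
  proof -
    have "I < ereal (i + 1 / real (Suc n))" using i by simp
    thus ?thesis by (auto simp: I_def INF_less_iff)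
  qed
  then obtain X where X: "\<And>n. ?h (X n) < ereal (i + 1 / real (Suc n))" by metis
  define a where "a n = real_of_ereal (f (X n))" for n
  have a: "f (X n) = ereal (a n)" for n
    using X[of n] by (cases rule: proper_realE[OF pr, of "X n"]) (auto simp: a_def)
  have Xr: "a n + (norm (X n - z))\<^sup>2 / 2 < i + 1 / real (Suc n)" for n
    using X[of n] a[of n] by simp
  \<comment> \<open>strong convexity, tested at the midpoint\<close>
  have gap: "(norm (X n - X m))\<^sup>2 \<le> 4 * (1 / real (Suc n) + 1 / real (Suc m))" for n m
  proof -
    let ?w = "(1 - 1/2) *\<^sub>R X n + (1/2) *\<^sub>R X m"
    have fw: "f ?w \<le> ereal ((1 - 1/2) * a n + (1/2) * a m)"
      by (rule convex_fun_ereal[OF cv]) (auto simp: a)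
    have "ereal i \<le> ?h ?w" unfolding i[symmetric] I_def by (rule INF_lower) simp
    also have "\<dots> \<le> ereal ((1 - 1/2) * a n + (1/2) * a m) + ereal ((norm (?w - z))\<^sup>2 / 2)"
      using fw by (intro add_mono) auto
    finally have "i \<le> (a n + a m) / 2 + (norm (?w - z))\<^sup>2 / 2" by (simp add: field_simps)
    moreover have "(norm (?w - z))\<^sup>2 = (norm (X n - z))\<^sup>2 / 2 + (norm (X m - z))\<^sup>2 / 2 - (norm (X n - X m))\<^sup>2 / 4"
      unfolding power2_norm_eq_inner
      by (simp add: inner_diff_left inner_diff_right inner_add_left inner_add_right inner_commute field_simps)
    ultimately show ?thesis using Xr[of n] Xr[of m] by argo
  qed
  have "Cauchy X"
  proof (rule metric_CauchyI)
    fix e :: real assume e: "e > 0"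
    obtain N where N: "8 / e\<^sup>2 < real (Suc N)"
      using reals_Archimedean2[of "8 / e\<^sup>2"] by (metis less_trans lessI of_nat_less_iff)
    have "dist (X n) (X m) < e" if "n \<ge> N" "m \<ge> N" for n m
    proof -
      have "1 / real (Suc n) \<le> 1 / real (Suc N)" "1 / real (Suc m) \<le> 1 / real (Suc N)"
        using that by (auto intro!: divide_left_mono)
      hence "(norm (X n - X m))\<^sup>2 \<le> 8 / real (Suc N)" using gap[of n m] by simp
      also have "\<dots> < e\<^sup>2" using N e by (simp add: field_simps)
      finally show ?thesis using e by (simp add: dist_norm power2_less_imp_less)
    qed
    thus "\<exists>M. \<forall>m\<ge>M. \<forall>n\<ge>M. dist (X m) (X n) < e" by blast
  qed
  then obtain u where u: "X \<longlonglongrightarrow> u" using convergent_eq_Cauchy Cauchy_convergent_iff convergent_def by blast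
  have lim: "(\<lambda>n. i + 1 / real (Suc n) - (norm (X n - z))\<^sup>2 / 2) \<longlonglongrightarrow> i + 0 - (norm (u - z))\<^sup>2 / 2"
    by (intro tendsto_intros u LIMSEQ_Suc[OF lim_1_over_n]) simp_all
  have "f u \<le> ereal (i - (norm (u - z))\<^sup>2 / 2)"
  proof (rule ccontr)
    assume "\<not> ?thesis"
    then obtain q where q: "ereal (i - (norm (u - z))\<^sup>2 / 2) < q" "q < f u"
      using dense[of "ereal (i - (norm (u - z))\<^sup>2 / 2)" "f u"] by (auto simp: not_le)
    then obtain q' where q': "q = ereal q'" by (cases q) auto
    have "\<forall>\<^sub>F n in sequentially. q < f (X n)"
      using eventually_compose_filterlim[OF lsc_eventually_nhds[OF ls q(2)] u] .
    moreover have "\<forall>\<^sub>F n in sequentially. i + 1 / real (Suc n) - (norm (X n - z))\<^sup>2 / 2 < q'"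
      using order_tendstoD(2)[OF lim, of q'] q q' by simp
    ultimately have "\<forall>\<^sub>F n in sequentially. False"
    proof eventually_elim
      case (elim n) thus False using Xr[of n] a[of n] q' by simp
    qed
    thus False by simp
  qed
  hence "?h u \<le> ereal (i - (norm (u - z))\<^sup>2 / 2) + ereal ((norm (u - z))\<^sup>2 / 2)"
    by (intro add_mono) auto
  hence "?h u \<le> I" using i by simp
  moreover have "I \<le> ?h v" for v unfolding I_def by (rule INF_lower) simp
  ultimately have "is_arg_min ?h (\<lambda>_. True) u"
    by (auto simp: is_arg_min_def not_less intro: order_trans)
  thus ?thesis unfolding prox_def arg_min_def by (rule someI[of "is_arg_min ?h (\<lambda>_. True)"])
qed

lemma linear_bound_imp_nonpos:
  fixes a B :: real
  assumes "\<And>t. 0 < t \<Longrightarrow> t < 1 \<Longrightarrow> a \<le> t * B"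
  shows "a \<le> 0"
proof -
  have "((\<lambda>t. t * B) \<longlongrightarrow> 0 * B) (at_right 0)" by (intro tendsto_intros)
  moreover have "\<forall>\<^sub>F t in at_right 0. a \<le> t * B"
    using assms by (auto simp: eventually_at_right[of 0 1] intro!: exI[of _ 1])
  ultimately show ?thesis by (simp add: tendsto_lowerbound)
qed

text \<open>
  Moving a fraction \<open>t\<close> of the way from the proximal point to \<open>w\<close> changes the quadratic term by
  its derivative plus a term of order \<open>t\<^sup>2\<close>; dividing by \<open>t\<close> and letting \<open>t\<close> tend to zero leaves
  the subgradient inequality.
\<close>

lemma prox_subdiff:
  fixes f :: "'a::{real_inner,complete_space} \<Rightarrow> ereal"
  assumes "proper_convex_lsc f"
  shows "z - prox f z \<in> subdiff f (prox f z)"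
proof -
  have pr: "proper f" and cv: "convex_fun f"
    using assms by (auto simp: proper_convex_lsc_def)
  define u where "u = prox f z"
  have min: "f u + ereal ((norm (u - z))\<^sup>2 / 2) \<le> f w + ereal ((norm (w - z))\<^sup>2 / 2)" for w
    using prox_is_arg_min[OF assms, of z] by (auto simp: is_arg_min_def not_less u_def)
  obtain x0 r where r: "f x0 = ereal r"
    using pr by (metis proper_def proper_realE)
  obtain a where a: "f u = ereal a"
    using min[of x0] r by (cases rule: proper_realE[OF pr, of u]) auto
  have "ereal a + ereal ((z - u) \<bullet> (w - u)) \<le> f w" for w
  proof (rule proper_realE[OF pr, of w])
    fix b assume b: "f w = ereal b"
    have "(z - u) \<bullet> (w - u) - (b - a) \<le> t * ((norm (w - u))\<^sup>2 / 2)" if t: "0 < t" "t < 1" for t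
    proof -
      let ?w = "(1 - t) *\<^sub>R u + t *\<^sub>R w"
      have fw: "f ?w \<le> ereal ((1 - t) * a + t * b)"
        by (rule convex_fun_ereal[OF cv t]) (auto simp: a b)
      have "ereal a + ereal ((norm (u - z))\<^sup>2 / 2) \<le> f ?w + ereal ((norm (?w - z))\<^sup>2 / 2)"
        using min[of ?w] a by simp
      also have "\<dots> \<le> ereal ((1 - t) * a + t * b) + ereal ((norm (?w - z))\<^sup>2 / 2)"
        using fw by (intro add_mono) auto
      finally have "a + (norm (u - z))\<^sup>2 / 2 \<le> (1 - t) * a + t * b + (norm (?w - z))\<^sup>2 / 2" by simp
      moreover have "?w - z = (u - z) + t *\<^sub>R (w - u)" by (simp add: algebra_simps)
      hence "(norm (?w - z))\<^sup>2 = (norm (u - z))\<^sup>2 - 2 * t * ((z - u) \<bullet> (w - u)) + t * t * (norm (w - u))\<^sup>2"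
        unfolding power2_norm_eq_inner by (simp add: inner_simps inner_commute algebra_simps)
      ultimately have "t * ((z - u) \<bullet> (w - u) - (b - a)) \<le> t * (t * ((norm (w - u))\<^sup>2 / 2))"
        by (simp add: algebra_simps)
      thus ?thesis using t by simp
    qed
    hence "(z - u) \<bullet> (w - u) - (b - a) \<le> 0"
      by (rule linear_bound_imp_nonpos)
    thus ?thesis using b by simp
  qed simp
  thus ?thesis using a by (simp add: subdiff_def u_def)
qed

section \<open>Riesz representation, adjoints and gradients\<close>

lemma continuous_imp_lsc:
  fixes f :: "'a::t2_space \<Rightarrow> real"
  assumes "continuous_on UNIV f"
  shows "lsc (\<lambda>x. ereal (f x))"
  unfolding lsc_def
proof
  fix x
  have "(f \<longlongrightarrow> f x) (at x)" using assms by (simp add: continuous_on_def)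
  thus "ereal (f x) \<le> Liminf (at x) (\<lambda>x. ereal (f x))"
    using lim_imp_Liminf[of "at x" "\<lambda>x. ereal (f x)" "ereal (f x)"]
    by (cases "at x = bot") simp_all
qed

lemma linear_proper_convex_lsc:
  assumes "bounded_linear \<phi>"
  shows "proper_convex_lsc (\<lambda>x. ereal (\<phi> x))"
proof -
  interpret bounded_linear \<phi> by fact
  show ?thesis
    by (auto simp: proper_convex_lsc_def proper_def convex_fun_def add scaleR
        intro!: continuous_imp_lsc linear_continuous_on assms)
qed

text \<open>
  The proximal point \<open>u\<close> of \<open>\<phi>\<close> at the origin satisfies \<open>- u \<in> \<partial>\<phi>(u)\<close>.  A subgradient
  inequality for a linear function holds in the directions \<open>h\<close> and \<open>- h\<close>, so it is an equality.
\<close>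

lemma riesz_representation:
  fixes \<phi> :: "'a::{real_inner,complete_space} \<Rightarrow> real"
  assumes "bounded_linear \<phi>"
  obtains g where "\<And>h. \<phi> h = g \<bullet> h"
proof -
  interpret bounded_linear \<phi> by fact
  define u where "u = prox (\<lambda>x. ereal (\<phi> x)) 0"
  have "0 - u \<in> subdiff (\<lambda>x. ereal (\<phi> x)) u"
    unfolding u_def by (intro prox_subdiff linear_proper_convex_lsc assms)
  hence *: "\<phi> u + (- u) \<bullet> (w - u) \<le> \<phi> w" for w by (auto simp: subdiff_def)
  have le: "- u \<bullet> h \<le> \<phi> h" for h using *[of "u + h"] by (simp add: add)
  have "\<phi> h = - u \<bullet> h" for h
    using le[of h] le[of "- h"] scaleR[of "-1" h] by simp
  thus ?thesis by (rule that)
qed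

lemma adjoint_inner:
  fixes f :: "'a::{real_inner,complete_space} \<Rightarrow> 'b::real_inner"
  assumes "bounded_linear f"
  shows "x \<bullet> adjoint f y = f x \<bullet> y"
proof -
  have "\<exists>g. \<forall>x. f x \<bullet> y = x \<bullet> g" for y
  proof -
    have "bounded_linear (\<lambda>x. f x \<bullet> y)"
      using bounded_linear_compose[OF bounded_linear_inner_left assms] by (simp add: o_def)
    then obtain g where "\<And>h. f h \<bullet> y = g \<bullet> h" by (rule riesz_representation) blast
    thus ?thesis by (auto simp: inner_commute)
  qed
  hence "\<exists>f'. \<forall>x y. f x \<bullet> y = x \<bullet> f' y" by metis
  hence "\<forall>x y. f x \<bullet> y = x \<bullet> adjoint f y" unfolding adjoint_def by (rule someI_ex)
  thus ?thesis by simp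
qed

lemma adjoint_blinfun_inner:
  fixes K :: "'a::{real_inner,complete_space} \<Rightarrow>\<^sub>L 'b::real_inner"
  shows "adjoint (blinfun_apply K) y \<bullet> x = y \<bullet> blinfun_apply K x"
  using adjoint_inner[OF blinfun.bounded_linear_right, of x K y] by (simp add: inner_commute)

lemma gderiv_unique:
  assumes "GDERIV f x :> g" "GDERIV f x :> g'"
  shows "g = g'"
proof -
  have "(\<lambda>h. h \<bullet> g) = (\<lambda>h. h \<bullet> g')"
    using assms unfolding gderiv_def by (rule has_derivative_unique)
  hence "(g - g') \<bullet> g = (g - g') \<bullet> g'" by metis
  hence "(g - g') \<bullet> (g - g') = 0" by (simp add: inner_diff_right)
  thus ?thesis by simp
qed

lemma gradientI:
  assumes "GDERIV (\<lambda>z. real_of_ereal (f z)) x :> g"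
  shows "gradient f x = g"
  unfolding gradient_def using assms gderiv_unique by blast

lemma gderiv_gradient:
  fixes E :: "'a::{real_inner,complete_space} \<Rightarrow> ereal"
  assumes "differentiable_fun E"
  shows "GDERIV (\<lambda>z. real_of_ereal (E z)) x :> gradient E x"
proof -
  obtain D where D: "((\<lambda>z. real_of_ereal (E z)) has_derivative D) (at x)"
    using assms by (auto simp: differentiable_fun_def differentiable_def)
  from has_derivative_bounded_linear[OF this] obtain g where "\<And>h. D h = g \<bullet> h"
    by (rule riesz_representation) blast
  hence "D = (\<lambda>h. h \<bullet> g)" by (auto simp: inner_commute)
  with D have "GDERIV (\<lambda>z. real_of_ereal (E z)) x :> g" by (simp add: gderiv_def)
  thus ?thesis using gradientI by metis
qed

lemma gradient_Ebar:
  fixes E :: "'a::{real_inner,complete_space} \<Rightarrow> ereal" and u :: "'a \<times> 'b::real_inner"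
  assumes "differentiable_fun E"
  shows "gradient (Ebar E) u = (gradient E (fst u), 0)"
proof (rule gradientI)
  have "((\<lambda>z. real_of_ereal (E z)) has_derivative (\<lambda>h. h \<bullet> gradient E (fst u))) (at (fst u))"
    using gderiv_gradient[OF assms] by (simp add: gderiv_def)
  hence "((\<lambda>z. real_of_ereal (E z)) \<circ> fst has_derivative (\<lambda>h. h \<bullet> gradient E (fst u)) \<circ> fst) (at u)"
    by (intro diff_chain_at) (auto intro: derivative_eq_intros)
  thus "GDERIV (\<lambda>z. real_of_ereal (Ebar E z)) u :> (gradient E (fst u), 0)"
    by (simp add: gderiv_def Ebar_def o_def inner_prod_def)
qed

section \<open>Smooth convex functions\<close>

lemma gderiv_along_line:
  assumes "\<And>x. GDERIV e x :> g x"
  shows "((\<lambda>t. e (x + t *\<^sub>R h)) has_real_derivative g (x + t *\<^sub>R h) \<bullet> h) (at t)"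
proof -
  have "(e \<circ> (\<lambda>t. x + t *\<^sub>R h) has_derivative (\<lambda>k. k \<bullet> g (x + t *\<^sub>R h)) \<circ> (\<lambda>k. k *\<^sub>R h)) (at t)"
    using assms[of "x + t *\<^sub>R h"] unfolding gderiv_def
    by (intro diff_chain_at) (auto intro!: derivative_eq_intros)
  thus ?thesis
    by (simp add: has_field_derivative_def o_def inner_commute mult_commute_abs)
qed

text \<open>
  Along the segment, the difference between \<open>e\<close> and its quadratic upper model has a
  nonpositive derivative: the Lipschitz bound on the change of the gradient is linear in \<open>t\<close>, and
  so is the derivative of the quadratic term.
\<close>

lemma descent_lemma:
  fixes e :: "'a::real_inner \<Rightarrow> real"
  assumes g: "\<And>x. GDERIV e x :> g x" and lip: "L-lipschitz_on UNIV g"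
  shows "e (x + h) \<le> e x + g x \<bullet> h + L / 2 * (norm h)\<^sup>2"
proof -
  let ?\<psi> = "\<lambda>t. e (x + t *\<^sub>R h) - t * (g x \<bullet> h) - L / 2 * (norm h)\<^sup>2 * t\<^sup>2"
  have "?\<psi> 1 \<le> ?\<psi> 0"
  proof (rule DERIV_nonpos_imp_nonincreasing[where f = ?\<psi>])
    fix t :: real assume t: "0 \<le> t"
    let ?d = "g (x + t *\<^sub>R h) \<bullet> h - g x \<bullet> h - L * (norm h)\<^sup>2 * t"
    have "(?\<psi> has_real_derivative ?d) (at t)"
      by (auto intro!: derivative_eq_intros gderiv_along_line[OF g])
    moreover have "(g (x + t *\<^sub>R h) - g x) \<bullet> h \<le> norm (g (x + t *\<^sub>R h) - g x) * norm h"
      by (rule norm_cauchy_schwarz)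
    moreover have "norm (g (x + t *\<^sub>R h) - g x) \<le> L * (t * norm h)"
      using lipschitz_onD[OF lip, of "x + t *\<^sub>R h" x] t by (simp add: dist_norm)
    hence "norm (g (x + t *\<^sub>R h) - g x) * norm h \<le> L * (t * norm h) * norm h"
      by (rule mult_right_mono) simp
    moreover have "L * (t * norm h) * norm h = L * (norm h)\<^sup>2 * t"
      by (simp add: power2_eq_square)
    ultimately show "\<exists>y. (?\<psi> has_real_derivative y) (at t) \<and> y \<le> 0"
      by (intro exI[of _ ?d]) (auto simp: inner_diff_left)
  qed simp
  thus ?thesis by simp
qed

lemma convex_gradient_inequality:
  fixes E :: "'a::{real_inner,complete_space} \<Rightarrow> ereal"
  assumes diff: "differentiable_fun E" and cv: "convex_fun E"
  shows "real_of_ereal (E x) + gradient E x \<bullet> (z - x) \<le> real_of_ereal (E z)"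
proof -
  let ?e = "\<lambda>z. real_of_ereal (E z)" and ?h = "z - x"
  have E: "E z = ereal (?e z)" for z
    using diff by (simp add: differentiable_fun_def ereal_real)
  have line: "((1 - t) * a + t * b) *\<^sub>R ?h + x = (1 - t) *\<^sub>R (x + a *\<^sub>R ?h) + t *\<^sub>R (x + b *\<^sub>R ?h)" for t a b :: real
    by (simp add: algebra_simps)
  have "convex_on UNIV (\<lambda>t. ?e (x + t *\<^sub>R ?h))"
  proof (rule convex_onI)
    fix t a b :: real assume t: "0 < t" "t < 1"
    have "E ((1 - t) *\<^sub>R (x + a *\<^sub>R ?h) + t *\<^sub>R (x + b *\<^sub>R ?h))
        \<le> ereal ((1 - t) * ?e (x + a *\<^sub>R ?h) + t * ?e (x + b *\<^sub>R ?h))"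
      by (rule convex_fun_ereal[OF cv t]) (simp_all flip: E)
    thus "?e (x + ((1 - t) *\<^sub>R a + t *\<^sub>R b) *\<^sub>R ?h) \<le> (1 - t) * ?e (x + a *\<^sub>R ?h) + t * ?e (x + b *\<^sub>R ?h)"
      unfolding line[symmetric] by (subst (asm) E) (simp add: add.commute)
  qed simp
  from convex_on_imp_above_tangent[OF this, of 0 1 "gradient E x \<bullet> ?h"]
  show ?thesis using gderiv_along_line[OF gderiv_gradient[OF diff], of x ?h 0] by simp
qed

section \<open>Scaling and conjugation\<close>

lemma proper_convex_lsc_scale:
  assumes f: "proper_convex_lsc f" and c: "0 < c"
  shows "proper_convex_lsc (\<lambda>x. ereal c * f x)"
  unfolding proper_convex_lsc_def
proof (intro conjI)
  have pr: "proper f" and cv: "convex_fun f" and ls: "lsc f"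
    using f by (auto simp: proper_convex_lsc_def)
  show "proper (\<lambda>x. ereal c * f x)"
    using pr c by (auto simp: proper_def)
  show "convex_fun (\<lambda>x. ereal c * f x)"
    unfolding convex_fun_def
  proof (intro allI impI, elim conjE)
    fix x y and t :: real assume t: "0 < t" "t < 1"
    have "ereal c * f ((1 - t) *\<^sub>R x + t *\<^sub>R y) \<le> ereal c * (ereal (1 - t) * f x + ereal t * f y)"
      using cv t c by (intro ereal_mult_left_mono) (auto simp: convex_fun_def)
    also have "\<dots> = ereal (1 - t) * (ereal c * f x) + ereal t * (ereal c * f y)"
      using t c
      by (cases rule: proper_realE[OF pr, of x]; cases rule: proper_realE[OF pr, of y])
         (simp_all add: algebra_simps)
    finally show "ereal c * f ((1 - t) *\<^sub>R x + t *\<^sub>R y)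
      \<le> ereal (1 - t) * (ereal c * f x) + ereal t * (ereal c * f y)" .
  qed
  show "lsc (\<lambda>x. ereal c * f x)"
    unfolding lsc_def
  proof
    fix x
    show "ereal c * f x \<le> Liminf (at x) (\<lambda>x. ereal c * f x)"
      using ls c by (cases "at x = bot")
        (auto simp: Liminf_ereal_mult_left lsc_def intro!: ereal_mult_left_mono)
  qed
qed

text \<open>
  As a supremum of affine functions the conjugate is convex and lower semicontinuous.  It is
  finite somewhere because \<open>G\<close> has a subgradient, for instance at a proximal point.
\<close>

lemma conjugate_proper_convex_lsc:
  fixes G :: "'a::{real_inner,complete_space} \<Rightarrow> ereal"
  assumes G: "proper_convex_lsc G"
  shows "proper_convex_lsc (conjugate G)"
  unfolding proper_convex_lsc_def
proof (intro conjI)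
  have pr: "proper G" using G by (simp add: proper_convex_lsc_def)
  have young: "ereal (p \<bullet> x) - G x \<le> conjugate G p" for p x
    unfolding conjugate_def by (rule SUP_upper) simp
  show "proper (conjugate G)"
    unfolding proper_def
  proof
    define u where "u = prox G 0"
    have "0 - u \<in> subdiff G u" unfolding u_def by (rule prox_subdiff[OF G])
    then obtain a where a: "G u = ereal a" "\<And>z. ereal (a + (- u) \<bullet> (z - u)) \<le> G z"
      by (auto simp: subdiff_def)
    have "ereal ((- u) \<bullet> x) - G x \<le> ereal ((- u) \<bullet> u - a)" for x
      using a(2)[of x] by (cases rule: proper_realE[OF pr, of x]) (auto simp: inner_diff_right)
    hence "conjugate G (- u) \<le> ereal ((- u) \<bullet> u - a)"
      unfolding conjugate_def by (intro SUP_least)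
    thus "\<exists>p. conjugate G p \<noteq> \<infinity>" by (intro exI[of _ "- u"]) auto
    show "\<forall>p. conjugate G p \<noteq> -\<infinity>"
    proof
      fix p show "conjugate G p \<noteq> -\<infinity>" using young[of p u] a(1) by auto
    qed
  qed
  show "convex_fun (conjugate G)"
    unfolding convex_fun_def
  proof (intro allI impI, elim conjE)
    fix p q and t :: real assume t: "0 < t" "t < 1"
    have "ereal (((1 - t) *\<^sub>R p + t *\<^sub>R q) \<bullet> x) - G x
        \<le> ereal (1 - t) * conjugate G p + ereal t * conjugate G q" for x
    proof -
      have "ereal (((1 - t) *\<^sub>R p + t *\<^sub>R q) \<bullet> x) - G x
        = ereal (1 - t) * (ereal (p \<bullet> x) - G x) + ereal t * (ereal (q \<bullet> x) - G x)"
        using t by (cases rule: proper_realE[OF pr, of x])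
          (auto simp: inner_simps algebra_simps)
      also have "\<dots> \<le> ereal (1 - t) * conjugate G p + ereal t * conjugate G q"
        using t young by (intro add_mono ereal_mult_left_mono) auto
      finally show ?thesis .
    qed
    thus "conjugate G ((1 - t) *\<^sub>R p + t *\<^sub>R q) \<le> ereal (1 - t) * conjugate G p + ereal t * conjugate G q"
      unfolding conjugate_def[of G "(1 - t) *\<^sub>R p + t *\<^sub>R q"] by (intro SUP_least)
  qed
  show "lsc (conjugate G)"
    unfolding lsc_def le_Liminf_iff
  proof (intro allI impI)
    fix p c assume "c < conjugate G p"
    then obtain x where x: "c < ereal (p \<bullet> x) - G x"
      by (auto simp: conjugate_def less_SUP_iff)
    then obtain r where r: "G x = ereal r" by (cases rule: proper_realE[OF pr, of x]) auto
    have "((\<lambda>q. ereal (q \<bullet> x - r)) \<longlongrightarrow> ereal (p \<bullet> x - r)) (at p)"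
      by (intro tendsto_intros)
    from order_tendstoD(1)[OF this, of c] x r
    have "\<forall>\<^sub>F q in at p. c < ereal (q \<bullet> x - r)" by simp
    thus "\<forall>\<^sub>F q in at p. c < conjugate G q"
    proof eventually_elim
      case (elim q) thus ?case using young[of q x] r by (auto intro: less_le_trans)
    qed
  qed
qed

section \<open>Adjoints and the operators of the primal-dual method\<close>

lemma bounded_linear_adjoint:
  fixes f :: "'a::{real_inner,complete_space} \<Rightarrow> 'b::real_inner"
  assumes "bounded_linear f"
  shows "bounded_linear (adjoint f)"
proof -
  obtain B where B: "0 \<le> B" "\<And>x. norm (f x) \<le> norm x * B"
    using bounded_linear.nonneg_bounded[OF assms] by blast
  have eqI: "a = b" if "\<And>x. x \<bullet> a = x \<bullet> b" for a b :: 'a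
    using that[of "a - b"] by (metis eq_iff_diff_eq_0 inner_diff_right inner_eq_zero_iff)
  show ?thesis
  proof (rule bounded_linear_intro[where K = "B"])
    show "adjoint f (x + y) = adjoint f x + adjoint f y" for x y
      by (rule eqI) (simp add: adjoint_inner[OF assms] inner_add_right)
    show "adjoint f (r *\<^sub>R x) = r *\<^sub>R adjoint f x" for r x
      by (rule eqI) (simp add: adjoint_inner[OF assms])
    fix y
    have "(norm (adjoint f y))\<^sup>2 = f (adjoint f y) \<bullet> y"
      by (simp add: power2_norm_eq_inner adjoint_inner[OF assms])
    also have "\<dots> \<le> norm (f (adjoint f y)) * norm y" by (rule norm_cauchy_schwarz)
    also have "\<dots> \<le> norm (adjoint f y) * B * norm y"
      using B by (intro mult_right_mono) auto
    finally have *: "norm (adjoint f y) * norm (adjoint f y) \<le> norm (adjoint f y) * (norm y * B)"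
      by (simp add: power2_eq_square mult_ac)
    show "norm (adjoint f y) \<le> norm y * B"
    proof (cases "adjoint f y = 0")
      case False
      thus ?thesis using * by simp
    next
      case True
      thus ?thesis using B(1) by simp
    qed
  qed
qed

lemma Xi_inner:
  fixes K :: "'x::{real_inner,complete_space} \<Rightarrow>\<^sub>L 'y::real_inner"
  shows "Xi_op K u \<bullet> v = snd u \<bullet> K (fst v) - K (fst u) \<bullet> snd v"
  by (simp add: Xi_op_def inner_prod_def adjoint_blinfun_inner)

lemma M_inner:
  fixes K :: "'x::{real_inner,complete_space} \<Rightarrow>\<^sub>L 'y::real_inner"
  shows "M_op \<tau> \<sigma> K u \<bullet> v = fst u \<bullet> fst v / \<tau> + snd u \<bullet> snd v / \<sigma>
           - snd u \<bullet> K (fst v) - K (fst u) \<bullet> snd v"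
  by (simp add: M_op_def inner_prod_def adjoint_blinfun_inner inner_diff_left inner_add_left)

lemma Xi_inner_commute:
  fixes K :: "'x::{real_inner,complete_space} \<Rightarrow>\<^sub>L 'y::real_inner"
  shows "Xi_op K u \<bullet> v = - (Xi_op K v \<bullet> u)"
  unfolding Xi_inner by (simp add: inner_commute)

lemma Xi_inner_self:
  fixes K :: "'x::{real_inner,complete_space} \<Rightarrow>\<^sub>L 'y::real_inner"
  shows "Xi_op K u \<bullet> u = 0"
  unfolding Xi_inner by (simp add: inner_commute)

lemma Xi_inner_diff:
  fixes K :: "'x::{real_inner,complete_space} \<Rightarrow>\<^sub>L 'y::real_inner"
  shows "Xi_op K (u - v) \<bullet> w = Xi_op K u \<bullet> w - Xi_op K v \<bullet> w"
  by (simp add: Xi_inner blinfun.diff_right inner_diff_left)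

lemma M_inner_commute:
  fixes K :: "'x::{real_inner,complete_space} \<Rightarrow>\<^sub>L 'y::real_inner"
  shows "M_op \<tau> \<sigma> K u \<bullet> v = M_op \<tau> \<sigma> K v \<bullet> u"
  unfolding M_inner by (simp add: inner_commute)

lemma M_inner_diff:
  fixes K :: "'x::{real_inner,complete_space} \<Rightarrow>\<^sub>L 'y::real_inner"
  shows "M_op \<tau> \<sigma> K (u - v) \<bullet> w = M_op \<tau> \<sigma> K u \<bullet> w - M_op \<tau> \<sigma> K v \<bullet> w"
  by (simp add: M_inner blinfun.diff_right inner_diff_left diff_divide_distrib)

lemma M_inner_add:
  fixes K :: "'x::{real_inner,complete_space} \<Rightarrow>\<^sub>L 'y::real_inner"
  shows "M_op \<tau> \<sigma> K (u + v) \<bullet> w = M_op \<tau> \<sigma> K u \<bullet> w + M_op \<tau> \<sigma> K v \<bullet> w"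
  by (simp add: M_inner blinfun.add_right inner_add_left add_divide_distrib)

lemma M_three_point:
  fixes K :: "'x::{real_inner,complete_space} \<Rightarrow>\<^sub>L 'y::real_inner"
  shows "2 * (M_op \<tau> \<sigma> K (a - b) \<bullet> (a - z)) =
    M_op \<tau> \<sigma> K (a - b) \<bullet> (a - b) + M_op \<tau> \<sigma> K (a - z) \<bullet> (a - z) - M_op \<tau> \<sigma> K (b - z) \<bullet> (b - z)"
  using M_inner_commute[of \<tau> \<sigma> K a b] M_inner_commute[of \<tau> \<sigma> K a z] M_inner_commute[of \<tau> \<sigma> K b z]
  by (simp add: M_inner_diff inner_diff_right)

lemma blinfun_inner_le:
  fixes K :: "'x::real_inner \<Rightarrow>\<^sub>L 'y::real_inner"
  shows "K x \<bullet> y \<le> norm K * norm x * norm y"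
proof -
  have "K x \<bullet> y \<le> norm (K x) * norm y" by (rule norm_cauchy_schwarz)
  also have "\<dots> \<le> norm K * norm x * norm y"
    by (intro mult_right_mono norm_blinfun) simp
  finally show ?thesis .
qed

text \<open>
  The coupling term is split so that \<open>\<parallel>y\<parallel>\<^sup>2 / \<sigma>\<close> is used up entirely; what remains is
  \<open>(1/\<tau> - \<sigma> \<parallel>K\<parallel>\<^sup>2) \<parallel>x\<parallel>\<^sup>2\<close>, which dominates \<open>L \<parallel>x\<parallel>\<^sup>2\<close> by the step length condition.
\<close>

lemma M_minus_Lambda_nonneg:
  fixes K :: "'x::{real_inner,complete_space} \<Rightarrow>\<^sub>L 'y::real_inner"
  assumes "\<tau> > 0" "\<sigma> > 0" "\<tau> * L + \<tau> * \<sigma> * (norm K)\<^sup>2 < 1"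
  shows "L * (norm (fst u))\<^sup>2 \<le> M_op \<tau> \<sigma> K u \<bullet> u"
proof -
  define a b k where "a = norm (fst u)" "b = norm (snd u)" "k = norm K"
  have 1: "K (fst u) \<bullet> snd u \<le> k * a * b"
    unfolding a_b_k_def by (rule blinfun_inner_le)
  \<comment> \<open>the weight in this square makes the \<open>b\<close> term exactly \<open>b\<^sup>2 / \<sigma>\<close>\<close>
  have "0 \<le> (\<sigma> * k * a - b)\<^sup>2 / \<sigma>" using assms by simp
  also have "\<dots> = \<sigma> * k\<^sup>2 * a\<^sup>2 - 2 * (k * a * b) + b\<^sup>2 / \<sigma>"
    using assms by (simp add: power2_eq_square field_simps)
  finally have 2: "2 * (k * a * b) \<le> \<sigma> * k\<^sup>2 * a\<^sup>2 + b\<^sup>2 / \<sigma>" by simp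
  have "L + \<sigma> * k\<^sup>2 \<le> 1 / \<tau>" using assms by (simp add: field_simps a_b_k_def)
  from mult_right_mono[OF this, of "a\<^sup>2"]
  have 3: "L * a\<^sup>2 + \<sigma> * k\<^sup>2 * a\<^sup>2 \<le> a\<^sup>2 / \<tau>" by (simp add: distrib_right)
  have "M_op \<tau> \<sigma> K u \<bullet> u = a\<^sup>2 / \<tau> + b\<^sup>2 / \<sigma> - 2 * (K (fst u) \<bullet> snd u)"
    unfolding M_inner by (simp add: a_b_k_def power2_norm_eq_inner inner_commute)
  with 1 2 3 show ?thesis unfolding a_b_k_def(1)[symmetric] by linarith
qed

text \<open>
  In the scaled norms \<open>\<alpha> = \<parallel>x\<parallel> / sqrt \<tau>\<close> and \<open>\<beta> = \<parallel>y\<parallel> / sqrt \<sigma>\<close> the coupling term is at most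
  \<open>2 sqrt (\<tau> \<sigma>) \<parallel>K\<parallel> \<alpha> \<beta>\<close>, which costs only the fraction \<open>sqrt (\<tau> \<sigma>) \<parallel>K\<parallel> < 1\<close> of \<open>\<alpha>\<^sup>2 + \<beta>\<^sup>2\<close>.
\<close>

lemma M_coercive:
  fixes K :: "'x::{real_inner,complete_space} \<Rightarrow>\<^sub>L 'y::real_inner"
  assumes "\<tau> > 0" "\<sigma> > 0" "\<tau> * \<sigma> * (norm K)\<^sup>2 < 1"
  shows "C_const \<tau> \<sigma> K > 0" and "C_const \<tau> \<sigma> K * (norm u)\<^sup>2 \<le> M_op \<tau> \<sigma> K u \<bullet> u"
proof -
  define a b k where "a = norm (fst u)" "b = norm (snd u)" "k = norm K"
  define \<mu> where "\<mu> = min (1 / \<tau>) (1 / \<sigma>)"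
  define c where "c = 1 - sqrt (\<tau> * \<sigma>) * k"
  have "(sqrt (\<tau> * \<sigma>) * k)\<^sup>2 < 1\<^sup>2"
    using assms by (simp add: power_mult_distrib a_b_k_def)
  hence c: "c > 0" unfolding c_def using power2_less_imp_less by fastforce
  have \<mu>: "\<mu> > 0" using assms by (simp add: \<mu>_def)
  have C: "C_const \<tau> \<sigma> K = c * \<mu>" by (simp add: C_const_def c_def \<mu>_def a_b_k_def)
  thus "C_const \<tau> \<sigma> K > 0" using c \<mu> by simp
  have 1: "K (fst u) \<bullet> snd u \<le> k * a * b"
    unfolding a_b_k_def by (rule blinfun_inner_le)
  define \<alpha> \<beta> where "\<alpha> = a / sqrt \<tau>" "\<beta> = b / sqrt \<sigma>"
  have ab: "a = sqrt \<tau> * \<alpha>" "b = sqrt \<sigma> * \<beta>" using assms by (auto simp: \<alpha>_\<beta>_def)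
  have sq: "\<alpha>\<^sup>2 = a\<^sup>2 / \<tau>" "\<beta>\<^sup>2 = b\<^sup>2 / \<sigma>" using assms by (auto simp: \<alpha>_\<beta>_def power_divide)
  have "0 \<le> (sqrt (\<tau> * \<sigma>) * k) * (\<alpha> - \<beta>)\<^sup>2" using assms by (simp add: a_b_k_def)
  also have "\<dots> = (1 - c) * (\<alpha>\<^sup>2 + \<beta>\<^sup>2) - 2 * (k * a * b)"
    unfolding ab c_def by (simp add: power2_eq_square algebra_simps real_sqrt_mult)
  finally have 2: "c * (\<alpha>\<^sup>2 + \<beta>\<^sup>2) \<le> \<alpha>\<^sup>2 + \<beta>\<^sup>2 - 2 * (k * a * b)" by (simp add: algebra_simps)
  have "\<mu> * a\<^sup>2 \<le> 1 / \<tau> * a\<^sup>2" "\<mu> * b\<^sup>2 \<le> 1 / \<sigma> * b\<^sup>2"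
    by (intro mult_right_mono; simp add: \<mu>_def)+
  hence "\<mu> * (a\<^sup>2 + b\<^sup>2) \<le> \<alpha>\<^sup>2 + \<beta>\<^sup>2" by (simp add: sq distrib_left)
  from mult_left_mono[OF this, of c] c
  have "c * \<mu> * (a\<^sup>2 + b\<^sup>2) \<le> c * (\<alpha>\<^sup>2 + \<beta>\<^sup>2)" by (simp add: mult.assoc)
  moreover have "M_op \<tau> \<sigma> K u \<bullet> u = \<alpha>\<^sup>2 + \<beta>\<^sup>2 - 2 * (K (fst u) \<bullet> snd u)"
    unfolding sq M_inner by (simp add: a_b_k_def power2_norm_eq_inner inner_commute)
  moreover have nu: "(norm u)\<^sup>2 = a\<^sup>2 + b\<^sup>2"
    by (simp add: a_b_k_def power2_norm_eq_inner inner_prod_def)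
  ultimately show "C_const \<tau> \<sigma> K * (norm u)\<^sup>2 \<le> M_op \<tau> \<sigma> K u \<bullet> u"
    using 1 2 unfolding C nu by linarith
qed

lemma Z_eq_M_minus_Xi: "Z_op \<tau> \<sigma> K u = M_op \<tau> \<sigma> K u - Xi_op K u"
  by (simp add: Z_op_def M_op_def Xi_op_def scaleR_2)

lemma bounded_linear_Z:
  fixes K :: "'x::{real_inner,complete_space} \<Rightarrow>\<^sub>L 'y::{real_inner,complete_space}"
  shows "bounded_linear (Z_op \<tau> \<sigma> K)"
proof -
  have K': "bounded_linear (\<lambda>u. adjoint (blinfun_apply K) (snd u))"
    by (rule bounded_linear_compose[OF bounded_linear_adjoint[OF blinfun.bounded_linear_right] bounded_linear_snd])
  have "bounded_linear (\<lambda>u. ((1 / \<tau>) *\<^sub>R fst u - 2 *\<^sub>R adjoint (blinfun_apply K) (snd u), (1 / \<sigma>) *\<^sub>R snd u))"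
    by (intro bounded_linear_Pair bounded_linear_sub bounded_linear_const_scaleR
        bounded_linear_fst bounded_linear_snd K')
  thus ?thesis by (simp add: Z_op_def[abs_def])
qed

text \<open>
  Young's inequality for \<open>e \<bullet> Z* b\<close>, with the weight \<open>\<epsilon> C\<close> chosen such that the \<open>Z* b\<close> part is
  the \<open>W\<close>-seminorm of \<open>b\<close> and the \<open>e\<close> part is controlled by the coercivity of \<open>M\<close>.
\<close>

lemma Z_young:
  fixes K :: "'x::{real_inner,complete_space} \<Rightarrow>\<^sub>L 'y::{real_inner,complete_space}"
  assumes "\<tau> > 0" "\<sigma> > 0" "\<tau> * \<sigma> * (norm K)\<^sup>2 < 1" and \<epsilon>: "\<epsilon> > 0"
  shows "Z_op \<tau> \<sigma> K e \<bullet> b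
    \<le> \<epsilon> / 2 * (M_op \<tau> \<sigma> K e \<bullet> e) + 1 / (2 * \<epsilon>) * (W_op \<tau> \<sigma> K b \<bullet> b)"
proof -
  let ?C = "C_const \<tau> \<sigma> K"
  note C = M_coercive[OF assms(1-3)]
  define z where "z = adjoint (Z_op \<tau> \<sigma> K) b"
  have adj: "Z_op \<tau> \<sigma> K v \<bullet> b = v \<bullet> z" for v
    unfolding z_def by (simp add: adjoint_inner bounded_linear_Z)
  have W: "W_op \<tau> \<sigma> K b \<bullet> b = (norm z)\<^sup>2 / ?C"
    unfolding W_op_def z_def[symmetric] by (simp add: adj power2_norm_eq_inner)
  have "0 \<le> (norm ((\<epsilon> * ?C) *\<^sub>R e - z))\<^sup>2 / (2 * \<epsilon> * ?C)"
    using C(1) \<epsilon> by simp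
  also have "\<dots> = \<epsilon> / 2 * (?C * (norm e)\<^sup>2) + (norm z)\<^sup>2 / (2 * \<epsilon> * ?C) - e \<bullet> z"
    unfolding power2_norm_eq_inner using C(1) \<epsilon>
    by (simp add: inner_diff_left inner_diff_right inner_commute field_simps)
  finally have "e \<bullet> z \<le> \<epsilon> / 2 * (?C * (norm e)\<^sup>2) + (norm z)\<^sup>2 / (2 * \<epsilon> * ?C)" by simp
  also have "\<epsilon> / 2 * (?C * (norm e)\<^sup>2) \<le> \<epsilon> / 2 * (M_op \<tau> \<sigma> K e \<bullet> e)"
    using C(2) \<epsilon> by (intro mult_left_mono) auto
  finally show ?thesis unfolding adj W by (simp add: mult_ac)
qed

lemma W_nonneg:
  fixes K :: "'x::{real_inner,complete_space} \<Rightarrow>\<^sub>L 'y::{real_inner,complete_space}"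
  assumes "\<tau> > 0" "\<sigma> > 0" "\<tau> * \<sigma> * (norm K)\<^sup>2 < 1"
  shows "0 \<le> W_op \<tau> \<sigma> K b \<bullet> b"
  unfolding W_op_def using M_coercive(1)[OF assms]
  by (simp add: adjoint_inner[OF bounded_linear_Z, symmetric])

lemma adjoint_restrict_inner:
  fixes P :: "'x::{real_inner,complete_space} \<Rightarrow>\<^sub>L 'xh::real_inner"
    and D :: "'y::{real_inner,complete_space} \<Rightarrow>\<^sub>L 'yh::real_inner"
  shows "p \<bullet> adjoint (restrict_op P D) h = restrict_op P D p \<bullet> h"
proof -
  have "bounded_linear (\<lambda>u. (blinfun_apply P (fst u), blinfun_apply D (snd u)))"
    by (intro bounded_linear_Pair bounded_linear_compose[OF blinfun.bounded_linear_right]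
        bounded_linear_fst bounded_linear_snd)
  hence "bounded_linear (restrict_op P D)" by (simp add: restrict_op_def[abs_def])
  thus ?thesis by (rule adjoint_inner)
qed

lemma restrict_add: "restrict_op P D (u + v) = restrict_op P D u + restrict_op P D v"
  by (simp add: restrict_op_def blinfun.add_right)

section \<open>Subdifferentials of the composite function\<close>

lemma prox_scaled_subdiff:
  fixes f :: "'a::{real_inner,complete_space} \<Rightarrow> ereal"
  assumes f: "proper_convex_lsc f" and c: "c > 0"
  shows "(1 / c) *\<^sub>R (z - prox (\<lambda>x. ereal c * f x) z) \<in> subdiff f (prox (\<lambda>x. ereal c * f x) z)"
proof -
  have pr: "proper f" using f by (simp add: proper_convex_lsc_def)
  define u where "u = prox (\<lambda>x. ereal c * f x) z"
  have *: "z - u \<in> subdiff (\<lambda>x. ereal c * f x) u"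
    unfolding u_def by (intro prox_subdiff proper_convex_lsc_scale f c)
  then obtain a where a: "f u = ereal a"
    using c by (cases rule: proper_realE[OF pr, of u]) (auto simp: subdiff_def)
  have "ereal (a + ((1 / c) *\<^sub>R (z - u)) \<bullet> (w - u)) \<le> f w" for w
  proof (rule proper_realE[OF pr, of w])
    fix b assume b: "f w = ereal b"
    have "c * a + (z - u) \<bullet> (w - u) \<le> c * b"
      using * a b by (auto simp: subdiff_def dest!: spec[of _ w])
    hence "a + ((z - u) \<bullet> (w - u)) / c \<le> b" using c by (simp add: field_simps)
    thus ?thesis using b by simp
  qed simp
  thus ?thesis unfolding u_def[symmetric] using a by (simp add: subdiff_def)
qed

lemma subdiff_Gbar_Pair:
  assumes "p \<in> subdiff F x" "q \<in> subdiff (conjugate G) y"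
  shows "(p, q) \<in> subdiff (Gbar F G) (x, y)"
proof -
  obtain a where a: "F x = ereal a" "\<And>z. ereal (a + p \<bullet> (z - x)) \<le> F z"
    using assms(1) by (auto simp: subdiff_def)
  obtain b where b: "conjugate G y = ereal b" "\<And>z. ereal (b + q \<bullet> (z - y)) \<le> conjugate G z"
    using assms(2) by (auto simp: subdiff_def)
  have "ereal (a + b) + ereal ((p, q) \<bullet> (z - (x, y))) \<le> Gbar F G z" for z
  proof -
    have "ereal (a + b) + ereal ((p, q) \<bullet> (z - (x, y)))
        = ereal (a + p \<bullet> (fst z - x)) + ereal (b + q \<bullet> (snd z - y))"
      by (simp add: inner_prod_def)
    also have "\<dots> \<le> Gbar F G z"
      unfolding Gbar_def by (intro add_mono a b)
    finally show ?thesis .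
  qed
  thus ?thesis using a(1) b(1)
    by (simp add: subdiff_def Gbar_def[of F G "(x, y)"] del: split_paired_All)
qed

lemma proper_convex_Gbar:
  fixes F :: "'x::{real_inner,complete_space} \<Rightarrow> ereal"
    and G :: "'y::{real_inner,complete_space} \<Rightarrow> ereal"
  assumes F: "proper_convex_lsc F" and G: "proper_convex_lsc G"
  shows "proper (Gbar F G)" and "convex_fun (Gbar F G)"
proof -
  note G' = conjugate_proper_convex_lsc[OF G]
  have prF: "proper F" and cvF: "convex_fun F" using F by (auto simp: proper_convex_lsc_def)
  have prG: "proper (conjugate G)" and cvG: "convex_fun (conjugate G)"
    using G' by (auto simp: proper_convex_lsc_def)
  obtain x0 y0 where "F x0 \<noteq> \<infinity>" "conjugate G y0 \<noteq> \<infinity>"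
    using prF prG by (auto simp: proper_def)
  thus "proper (Gbar F G)"
    using prF prG unfolding proper_def by (auto simp: Gbar_def intro!: exI[of _ "(x0, y0)"])
  show "convex_fun (Gbar F G)"
    unfolding convex_fun_def
  proof (intro allI impI, elim conjE)
    fix u v :: "'x \<times> 'y" and t :: real assume t: "0 < t" "t < 1"
    have "Gbar F G ((1 - t) *\<^sub>R u + t *\<^sub>R v)
      \<le> (ereal (1 - t) * F (fst u) + ereal t * F (fst v))
         + (ereal (1 - t) * conjugate G (snd u) + ereal t * conjugate G (snd v))"
      unfolding Gbar_def using cvF cvG t by (intro add_mono) (auto simp: convex_fun_def)
    also have "\<dots> = ereal (1 - t) * Gbar F G u + ereal t * Gbar F G v"
      unfolding Gbar_def using t
      by (cases rule: proper_realE[OF prF, of "fst u"]; cases rule: proper_realE[OF prF, of "fst v"];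
          cases rule: proper_realE[OF prG, of "snd u"]; cases rule: proper_realE[OF prG, of "snd v"])
        (simp_all add: algebra_simps)
    finally show "Gbar F G ((1 - t) *\<^sub>R u + t *\<^sub>R v)
      \<le> ereal (1 - t) * Gbar F G u + ereal t * Gbar F G v" .
  qed
qed

lemma subdiffD_real:
  assumes "p \<in> subdiff f x" "\<bar>f z\<bar> \<noteq> \<infinity>"
  shows "real_of_ereal (f x) + p \<bullet> (z - x) \<le> real_of_ereal (f z)"
  using assms by (cases "f x"; cases "f z") (auto simp: subdiff_def dest!: spec[of _ z])

text \<open>
  The nontrivial inclusion of the sum rule, for \<open>g\<close> convex and \<open>e\<close> bounded above by a quadratic
  model at \<open>a\<close> with slope \<open>c\<close>.  On a segment of length of order \<open>t\<close> the quadratic error is of order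
  \<open>t\<^sup>2\<close>, while \<open>g\<close> increases by at most \<open>t\<close> times its total increase.
\<close>

lemma subdiff_minus_smooth:
  fixes g :: "'a::real_inner \<Rightarrow> ereal" and e :: "'a \<Rightarrow> real"
  assumes pr: "proper g" and cv: "convex_fun g"
    and e: "\<And>h. e (a + h) \<le> e a + c \<bullet> h + B * (norm h)\<^sup>2"
    and p: "p \<in> subdiff (\<lambda>u. g u + ereal (e u)) a"
  shows "p - c \<in> subdiff g a"
proof -
  obtain ga where ga: "g a = ereal ga"
    using p by (cases "g a") (auto simp: subdiff_def)
  have "ereal ga + ereal ((p - c) \<bullet> (z - a)) \<le> g z" for z
  proof (rule proper_realE[OF pr, of z])
    fix gz assume gz: "g z = ereal gz"
    define h where "h = z - a"
    have "(p - c) \<bullet> h - (gz - ga) \<le> t * (B * (norm h)\<^sup>2)" if t: "0 < t" "t < 1" for t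
    proof -
      have "a + t *\<^sub>R h = (1 - t) *\<^sub>R a + t *\<^sub>R z" by (simp add: h_def algebra_simps)
      hence gw: "g (a + t *\<^sub>R h) \<le> ereal ((1 - t) * ga + t * gz)"
        using convex_fun_ereal[OF cv t, of a ga z gz] by (simp add: ga gz)
      have "ereal (ga + e a + t * (p \<bullet> h)) \<le> g (a + t *\<^sub>R h) + ereal (e (a + t *\<^sub>R h))"
        using p ga by (auto simp: subdiff_def dest!: spec[of _ "a + t *\<^sub>R h"])
      also have "\<dots> \<le> ereal ((1 - t) * ga + t * gz) + ereal (e (a + t *\<^sub>R h))"
        using gw by (rule add_right_mono)
      finally have "ga + e a + t * (p \<bullet> h) \<le> (1 - t) * ga + t * gz + e (a + t *\<^sub>R h)" by simp
      moreover have "e (a + t *\<^sub>R h) \<le> e a + t * (c \<bullet> h) + t * (t * (B * (norm h)\<^sup>2))"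
        using e[of "t *\<^sub>R h"] by (simp add: power_mult_distrib power2_eq_square mult_ac)
      ultimately have "t * ((p - c) \<bullet> h - (gz - ga)) \<le> t * (t * (B * (norm h)\<^sup>2))"
        by (simp add: algebra_simps inner_diff_left)
      thus ?thesis using t by simp
    qed
    hence "(p - c) \<bullet> h - (gz - ga) \<le> 0" by (rule linear_bound_imp_nonpos)
    thus ?thesis using gz by (simp add: h_def)
  qed simp
  thus ?thesis using ga by (simp add: subdiff_def)
qed

section \<open>The preconditioned forward-backward step\<close>

lemma pd_structureD:
  assumes "pd_structure F E G K L \<tau> \<sigma>"
  shows "proper_convex_lsc F" "convex_fun E" "proper_convex_lsc G" "differentiable_fun E"
    "L-lipschitz_on UNIV (gradient E)" "\<tau> > 0" "\<sigma> > 0"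
    "\<tau> * L + \<tau> * \<sigma> * (norm K)\<^sup>2 < 1" "L \<ge> 0" "\<tau> * \<sigma> * (norm K)\<^sup>2 < 1"
proof -
  show *: "proper_convex_lsc F" "convex_fun E" "proper_convex_lsc G" "differentiable_fun E"
    "L-lipschitz_on UNIV (gradient E)" "\<tau> > 0" "\<sigma> > 0"
    and **: "\<tau> * L + \<tau> * \<sigma> * (norm K)\<^sup>2 < 1"
    using assms by (auto simp: pd_structure_def proper_convex_lsc_def)
  show "L \<ge> 0" using *(5) by (rule lipschitz_on_nonneg)
  hence "0 \<le> \<tau> * L" using *(6) by simp
  thus "\<tau> * \<sigma> * (norm K)\<^sup>2 < 1" using ** by linarith
qed

lemma Ebar_descent:
  fixes E :: "'x::{real_inner,complete_space} \<Rightarrow> ereal" and u h :: "'x \<times> 'y::real_inner"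
  assumes diff: "differentiable_fun E" and lip: "L-lipschitz_on UNIV (gradient E)"
  shows "real_of_ereal (Ebar E (u + h))
    \<le> real_of_ereal (Ebar E u) + gradient (Ebar E) u \<bullet> h + L / 2 * (norm (fst h))\<^sup>2"
  using descent_lemma[OF gderiv_gradient[OF diff] lip, of "fst u" "fst h"]
  by (simp add: gradient_Ebar[OF diff] Ebar_def inner_prod_def)

lemma Ebar_gradient_inequality:
  fixes E :: "'x::{real_inner,complete_space} \<Rightarrow> ereal" and u z :: "'x \<times> 'y::real_inner"
  assumes diff: "differentiable_fun E" and cv: "convex_fun E"
  shows "real_of_ereal (Ebar E u) + gradient (Ebar E) u \<bullet> (z - u) \<le> real_of_ereal (Ebar E z)"
  using convex_gradient_inequality[OF diff cv, of "fst u" "fst z"]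
  by (simp add: gradient_Ebar[OF diff] Ebar_def inner_prod_def)

text \<open>
  A real-valued version of \<open>Gbar + Ebar\<close>, so that estimates between points where \<open>Gbar\<close> is finite
  are linear arithmetic over the reals.
\<close>

definition objective ::
  "('x \<Rightarrow> ereal) \<Rightarrow> ('x \<Rightarrow> ereal) \<Rightarrow> ('y::real_inner \<Rightarrow> ereal) \<Rightarrow> 'x \<times> 'y \<Rightarrow> real" where
  "objective F E G u = real_of_ereal (Gbar F G u) + real_of_ereal (Ebar E u)"

text \<open>
  One inequality serves all three schemes; they differ only in \<open>r\<close> and in the comparison point.
  The fine step has \<open>r = \<Xi> a\<close> and \<open>z\<close> arbitrary; the coarse steps have \<open>r = \<Xi> (a - z) + s\<close>, with
  \<open>z\<close> the initial iterate if \<open>\<vartheta> = 1\<close> and the previous one if \<open>\<vartheta> = 0\<close>.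
\<close>

lemma pd_step_inequality:
  fixes F E :: "'x::{real_inner,complete_space} \<Rightarrow> ereal"
    and G :: "'y::{real_inner,complete_space} \<Rightarrow> ereal"
  assumes st: "pd_structure F E G K L \<tau> \<sigma>"
    and step: "- (gradient (Ebar E) b + r + M_op \<tau> \<sigma> K (a - b)) \<in> subdiff (Gbar F G) a"
    and z: "\<bar>Gbar F G z\<bar> \<noteq> \<infinity>"
  shows "objective F E G a + r \<bullet> (a - z) + 1/2 * (M_op \<tau> \<sigma> K (a - z) \<bullet> (a - z))
      + 1/2 * (M_op \<tau> \<sigma> K (a - b) \<bullet> (a - b) - L * (norm (fst (a - b)))\<^sup>2)
    \<le> objective F E G z + 1/2 * (M_op \<tau> \<sigma> K (b - z) \<bullet> (b - z))"
proof -
  note st = pd_structureD[OF st]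
  have "real_of_ereal (Gbar F G a) + gradient (Ebar E) b \<bullet> (a - z) + r \<bullet> (a - z)
      + M_op \<tau> \<sigma> K (a - b) \<bullet> (a - z) \<le> real_of_ereal (Gbar F G z)"
    using subdiffD_real[OF step z] by (simp add: inner_diff_left inner_diff_right inner_add_left)
  moreover have "real_of_ereal (Ebar E a)
      \<le> real_of_ereal (Ebar E b) + gradient (Ebar E) b \<bullet> (a - b) + L / 2 * (norm (fst (a - b)))\<^sup>2"
    using Ebar_descent[OF st(4,5), of b "a - b"] by simp
  moreover have "real_of_ereal (Ebar E b) + gradient (Ebar E) b \<bullet> (z - b) \<le> real_of_ereal (Ebar E z)"
    by (rule Ebar_gradient_inequality[OF st(4,2)])
  moreover have "gradient (Ebar E) b \<bullet> (a - z) = gradient (Ebar E) b \<bullet> (a - b) - gradient (Ebar E) b \<bullet> (z - b)"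
    by (simp add: inner_diff_right)
  ultimately show ?thesis using M_three_point[of \<tau> \<sigma> K a b z] unfolding objective_def by argo
qed

text \<open>
  The rows of \<open>M\<close> and \<open>\<Xi>\<close> are made to cancel the implicit terms: the \<open>K*\<close> contributions of
  \<open>\<Xi> u\<^sub>p\<close> and of \<open>M (u\<^sub>p - u\<^sub>k)\<close> leave the old dual variable in the first row, and in the second
  row the \<open>K\<close> contributions combine to the extrapolated point \<open>2 x\<^sub>p - x\<close>.
\<close>

lemma fine_step_inclusion:
  fixes F E :: "'x::{real_inner,complete_space} \<Rightarrow> ereal"
    and G :: "'y::{real_inner,complete_space} \<Rightarrow> ereal"
  assumes st: "pd_structure F E G K L \<tau> \<sigma>"
    and xp: "xp = prox (\<lambda>z. ereal \<tau> * F z) (x - \<tau> *\<^sub>R (gradient E x + adjoint (blinfun_apply K) y))"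
    and yp: "yp = prox (\<lambda>z. ereal \<sigma> * conjugate G z) (y + \<sigma> *\<^sub>R blinfun_apply K (2 *\<^sub>R xp - x))"
  shows "- (gradient (Ebar E) (x, y) + Xi_op K (xp, yp) + M_op \<tau> \<sigma> K ((xp, yp) - (x, y)))
    \<in> subdiff (Gbar F G) (xp, yp)"
proof -
  note st = pd_structureD[OF st]
  let ?p = "(1 / \<tau>) *\<^sub>R (x - \<tau> *\<^sub>R (gradient E x + adjoint (blinfun_apply K) y) - xp)"
  let ?q = "(1 / \<sigma>) *\<^sub>R (y + \<sigma> *\<^sub>R blinfun_apply K (2 *\<^sub>R xp - x) - yp)"
  have adj: "adjoint (blinfun_apply K) (yp - y) = adjoint (blinfun_apply K) yp - adjoint (blinfun_apply K) y"
    by (rule linear_diff) (intro bounded_linear.linear bounded_linear_adjoint blinfun.bounded_linear_right)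
  have "?p \<in> subdiff F xp" unfolding xp by (rule prox_scaled_subdiff[OF st(1,6)])
  moreover have "?q \<in> subdiff (conjugate G) yp"
    unfolding yp by (rule prox_scaled_subdiff[OF conjugate_proper_convex_lsc[OF st(3)] st(7)])
  ultimately have "(?p, ?q) \<in> subdiff (Gbar F G) (xp, yp)" by (rule subdiff_Gbar_Pair)
  moreover have "(?p, ?q)
    = - (gradient (Ebar E) (x, y) + Xi_op K (xp, yp) + M_op \<tau> \<sigma> K ((xp, yp) - (x, y)))"
    using st(6,7)
    by (simp add: gradient_Ebar[OF st(4)] Xi_op_def M_op_def adj algebra_simps
        blinfun.diff_right blinfun.add_right scaleR_2)
  ultimately show ?thesis by simp
qed

section \<open>Slope of the coarse direction\<close>

text \<open>
  The vector \<open>c = q + \<nabla>Ebar (v 0) + s\<close> is a subgradient of \<open>\<Psi> = Gbar + Ebar + s \<bullet> (\<cdot>)\<close> at \<open>v 0\<close>, hence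
  \<open>c \<bullet> (v j - v 0) \<le> \<Psi> (v j) - \<Psi> (v 0)\<close>.  In each coarse step the term \<open>\<Xi> (v (Suc j) - z)\<close> is
  orthogonal to \<open>v (Suc j) - z\<close>, where \<open>z\<close> is the anchor point.  For \<open>\<vartheta> = 0\<close> the anchor is
  \<open>v j\<close> and no step increases \<open>\<Psi>\<close>.  For \<open>\<vartheta> = 1\<close> it is \<open>v 0\<close>; then single steps need not
  decrease \<open>\<Psi>\<close>, but the squared \<open>M\<close>-distances to \<open>v 0\<close> telescope, so the ergodic average
  works: \<open>c \<bullet> (\<cdot>)\<close> is linear, which replaces Jensen's inequality.
\<close>

lemma coarse_direction_nonascent:
  fixes F E :: "'x::{real_inner,complete_space} \<Rightarrow> ereal"
    and G :: "'y::{real_inner,complete_space} \<Rightarrow> ereal"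
    and v :: "nat \<Rightarrow> 'x \<times> 'y"
  assumes st: "pd_structure F E G K L \<tau> \<sigma>"
    and q: "q \<in> subdiff (Gbar F G) (v 0)"
    and m: "m \<ge> 1" and vtheta: "vtheta \<in> {0, 1}"
    and steps: "\<And>j. j < m \<Longrightarrow>
      - (Xi_op K (v (Suc j) - ((1 - vtheta) *\<^sub>R v j + vtheta *\<^sub>R v 0))
         + gradient (Ebar E) (v j) + s + M_op \<tau> \<sigma> K (v (Suc j) - v j))
        \<in> subdiff (Gbar F G) (v (Suc j))"
    and vt: "vt = (if vtheta = 1 then (1 / real m) *\<^sub>R (\<Sum>j<m. v (Suc j)) else v m)"
  shows "(q + gradient (Ebar E) (v 0) + s) \<bullet> (vt - v 0) \<le> 0"
proof -
  note st' = pd_structureD[OF st]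
  let ?\<Psi> = "\<lambda>u. objective F E G u + s \<bullet> u"
  define c where "c = q + gradient (Ebar E) (v 0) + s"
  have fin: "\<bar>Gbar F G (v j)\<bar> \<noteq> \<infinity>" if "j \<le> m" for j
  proof (cases j)
    case 0 thus ?thesis using q by (simp add: subdiff_def)
  next
    case (Suc i)
    with steps[of i] that show ?thesis by (simp add: subdiff_def)
  qed
  have tangent: "c \<bullet> (v j - v 0) \<le> ?\<Psi> (v j) - ?\<Psi> (v 0)" if "j \<le> m" for j
    using subdiffD_real[OF q fin[OF that]] Ebar_gradient_inequality[OF st'(4,2), of "v 0" "v j"]
    by (simp add: objective_def c_def inner_add_left inner_diff_right)
  let ?N = "\<lambda>u. 1/2 * (M_op \<tau> \<sigma> K u \<bullet> u)"
  have psd: "0 \<le> M_op \<tau> \<sigma> K u \<bullet> u - L * (norm (fst u))\<^sup>2" for u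
    using M_minus_Lambda_nonneg[OF st'(6,7,8), of u] by simp
  have M0: "0 \<le> M_op \<tau> \<sigma> K u \<bullet> u" for u
    using psd[of u] st'(9) by (smt (verit) mult_nonneg_nonneg zero_le_power2)
  have stp: "?\<Psi> (v (Suc j)) + ?N (v (Suc j) - z) \<le> ?\<Psi> z + ?N (v j - z)"
    if j: "j < m" and z: "\<bar>Gbar F G z\<bar> \<noteq> \<infinity>" and zd: "z = (1 - vtheta) *\<^sub>R v j + vtheta *\<^sub>R v 0" for j z
  proof -
    let ?r = "Xi_op K (v (Suc j) - z) + s"
    have "- (gradient (Ebar E) (v j) + ?r + M_op \<tau> \<sigma> K (v (Suc j) - v j)) \<in> subdiff (Gbar F G) (v (Suc j))"
      using steps[OF j] unfolding zd[symmetric] by (simp add: add_ac)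
    from pd_step_inequality[OF st this z] psd[of "v (Suc j) - v j"]
    have "objective F E G (v (Suc j)) + ?r \<bullet> (v (Suc j) - z) + ?N (v (Suc j) - z)
      \<le> objective F E G z + ?N (v j - z)" by argo
    moreover have "?r \<bullet> (v (Suc j) - z) = s \<bullet> v (Suc j) - s \<bullet> z"
      unfolding inner_add_left Xi_inner_self by (simp add: inner_diff_right)
    ultimately show ?thesis by argo
  qed
  from vtheta consider "vtheta = 0" | "vtheta = 1" by auto
  hence "c \<bullet> (vt - v 0) \<le> 0"
  proof cases
    case 1
    have dec: "?\<Psi> (v (Suc j)) \<le> ?\<Psi> (v j)" if "j < m" for j
    proof -
      have "?\<Psi> (v (Suc j)) + ?N (v (Suc j) - v j) \<le> ?\<Psi> (v j) + ?N (v j - v j)"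
        by (rule stp) (use that fin 1 in auto)
      moreover have "?N (v j - v j) = 0" by (simp add: M_inner)
      ultimately show ?thesis using M0[of "v (Suc j) - v j"] by linarith
    qed
    have "j \<le> m \<Longrightarrow> ?\<Psi> (v j) \<le> ?\<Psi> (v 0)" for j
    proof (induction j)
      case (Suc j) thus ?case using dec[of j] by simp
    qed simp
    from this[of m] tangent[of m] show ?thesis using 1 vt by simp
  next
    case 2
    have "(\<Sum>j<m. c \<bullet> (v (Suc j) - v 0)) \<le> (\<Sum>j<m. ?N (v j - v 0) - ?N (v (Suc j) - v 0))"
    proof (rule sum_mono)
      fix j assume "j \<in> {..<m}"
      hence j: "j < m" by simp
      have "?\<Psi> (v (Suc j)) + ?N (v (Suc j) - v 0) \<le> ?\<Psi> (v 0) + ?N (v j - v 0)"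
        by (rule stp) (use j fin 2 in auto)
      thus "c \<bullet> (v (Suc j) - v 0) \<le> ?N (v j - v 0) - ?N (v (Suc j) - v 0)"
        using tangent[of "Suc j"] j by simp
    qed
    also have "\<dots> = ?N (v 0 - v 0) - ?N (v m - v 0)"
      using sum_lessThan_telescope'[of "\<lambda>j. ?N (v j - v 0)" m] by simp
    also have "\<dots> \<le> 0"
    proof -
      have "?N (v 0 - v 0) = 0" by (simp add: M_inner)
      thus ?thesis using M0[of "v m - v 0"] by linarith
    qed
    finally have le: "(\<Sum>j<m. c \<bullet> (v (Suc j) - v 0)) \<le> 0" .
    have "vt - v 0 = (1 / real m) *\<^sub>R (\<Sum>j<m. v (Suc j) - v 0)"
      using m 2 by (simp add: vt sum_subtractf scaleR_diff_right sum_constant_scaleR)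
    hence "c \<bullet> (vt - v 0) = (1 / real m) * (\<Sum>j<m. c \<bullet> (v (Suc j) - v 0))"
      by (simp add: inner_sum_right)
    also have "\<dots> \<le> 0" using le by (intro mult_nonneg_nonpos) auto
    finally show ?thesis .
  qed
  thus ?thesis by (simp add: c_def)
qed

lemma subdiff_Phi_imp_Gbar:
  fixes F E :: "'x::{real_inner,complete_space} \<Rightarrow> ereal"
    and G :: "'y::{real_inner,complete_space} \<Rightarrow> ereal"
  assumes st: "pd_structure F E G K L \<tau> \<sigma>"
    and p: "p \<in> subdiff (\<lambda>u. Phi F E G K u uh) a"
  shows "p - (gradient (Ebar E) a + Xi_op K uh) \<in> subdiff (Gbar F G) a"
proof (rule subdiff_minus_smooth[where e = "\<lambda>u. real_of_ereal (Ebar E u) + Xi_op K uh \<bullet> u" and B = "L / 2"])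
  note st = pd_structureD[OF st]
  show "proper (Gbar F G)" "convex_fun (Gbar F G)"
    by (rule proper_convex_Gbar[OF st(1,3)])+
  have E: "Ebar E u = ereal (real_of_ereal (Ebar E u))" for u :: "'x \<times> 'y"
    using st(4) by (simp add: differentiable_fun_def Ebar_def ereal_real)
  have "Phi F E G K u uh = Gbar F G u + ereal (real_of_ereal (Ebar E u) + Xi_op K uh \<bullet> u)" for u
    unfolding Phi_def by (subst E) (simp add: add.assoc)
  thus "p \<in> subdiff (\<lambda>u. Gbar F G u + ereal (real_of_ereal (Ebar E u) + Xi_op K uh \<bullet> u)) a"
    using p by simp
  fix h :: "'x \<times> 'y"
  have "(norm (fst h))\<^sup>2 \<le> (norm h)\<^sup>2"
    using norm_fst_le[of "fst h" "snd h"] by (intro power_mono) auto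
  hence "L / 2 * (norm (fst h))\<^sup>2 \<le> L / 2 * (norm h)\<^sup>2"
    using st(9) by (intro mult_left_mono) auto
  with Ebar_descent[OF st(4,5), of a h]
  show "real_of_ereal (Ebar E (a + h)) + Xi_op K uh \<bullet> (a + h)
    \<le> real_of_ereal (Ebar E a) + Xi_op K uh \<bullet> a + (gradient (Ebar E) a + Xi_op K uh) \<bullet> h + L / 2 * (norm h)\<^sup>2"
    by (simp add: inner_add_left inner_add_right)
qed

section \<open>Combining the step inequality with the line search\<close>

lemma Phi_cases:
  fixes F E :: "'x::{real_inner,complete_space} \<Rightarrow> ereal"
    and G :: "'y::{real_inner,complete_space} \<Rightarrow> ereal"
  assumes st: "pd_structure F E G K L \<tau> \<sigma>"
  obtains "Gbar F G u = \<infinity>" "\<And>w. Phi F E G K u w = \<infinity>"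
    | "\<bar>Gbar F G u\<bar> \<noteq> \<infinity>" "\<And>w. Phi F E G K u w = ereal (objective F E G u + Xi_op K w \<bullet> u)"
proof -
  note st = pd_structureD[OF st]
  have E: "Ebar E u = ereal (real_of_ereal (Ebar E u))"
    using st(4) by (simp add: differentiable_fun_def Ebar_def ereal_real)
  show ?thesis
  proof (rule proper_realE[OF proper_convex_Gbar(1)[OF st(1,3)], of u])
    assume "Gbar F G u = \<infinity>"
    thus ?thesis by (intro that(1)) (simp_all add: Phi_def)
  next
    fix r assume r: "Gbar F G u = ereal r"
    have "Phi F E G K u w = ereal (objective F E G u + Xi_op K w \<bullet> u)" for w
      unfolding Phi_def objective_def r by (subst E) simp
    with r show ?thesis by (intro that(2)) auto
  qed
qed

lemma opnorm_M:
  fixes K :: "'x::{real_inner,complete_space} \<Rightarrow>\<^sub>L 'y::{real_inner,complete_space}"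
  assumes "\<tau> > 0" "\<sigma> > 0" "\<tau> * \<sigma> * (norm K)\<^sup>2 < 1"
  shows "(opnorm (M_op \<tau> \<sigma> K) u)\<^sup>2 = M_op \<tau> \<sigma> K u \<bullet> u"
    and "(opnorm (W_op \<tau> \<sigma> K) u)\<^sup>2 = W_op \<tau> \<sigma> K u \<bullet> u"
proof -
  have "0 \<le> C_const \<tau> \<sigma> K * (norm u)\<^sup>2" using M_coercive(1)[OF assms] by simp
  also have "\<dots> \<le> M_op \<tau> \<sigma> K u \<bullet> u" by (rule M_coercive(2)[OF assms])
  finally show "(opnorm (M_op \<tau> \<sigma> K) u)\<^sup>2 = M_op \<tau> \<sigma> K u \<bullet> u" by (simp add: opnorm_def)
  show "(opnorm (W_op \<tau> \<sigma> K) u)\<^sup>2 = W_op \<tau> \<sigma> K u \<bullet> u"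
    using W_nonneg[OF assms, of u] by (simp add: opnorm_def)
qed

lemma opnorm_M_minus_Lambda:
  fixes K :: "'x::{real_inner,complete_space} \<Rightarrow>\<^sub>L 'y::real_inner"
  assumes "\<tau> > 0" "\<sigma> > 0" "\<tau> * L + \<tau> * \<sigma> * (norm K)\<^sup>2 < 1"
  shows "(opnorm (\<lambda>u. M_op \<tau> \<sigma> K u - Lambda_op L u) u)\<^sup>2 = M_op \<tau> \<sigma> K u \<bullet> u - L * (norm (fst u))\<^sup>2"
proof -
  have "(M_op \<tau> \<sigma> K u - Lambda_op L u) \<bullet> u = M_op \<tau> \<sigma> K u \<bullet> u - L * (norm (fst u))\<^sup>2"
    by (simp add: inner_diff_left Lambda_op_def inner_prod_def[of "(_, _)"] power2_norm_eq_inner)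
  thus ?thesis using M_minus_Lambda_nonneg[OF assms, of u] by (simp add: opnorm_def)
qed

text \<open>
  Expansion of the left-hand side around \<open>a\<close>: the terms linear in \<open>b\<close> that are not part of
  \<open>\<Phi>(a + b; a)\<close> are \<open>M (a - uh) \<bullet> b\<close> from the squared norm and \<open>\<Xi> (uh - a) \<bullet> b\<close> from changing the
  second argument of \<open>\<Phi>\<close>; their sum is \<open>Z (a - uh) \<bullet> b\<close>.  If \<open>\<Phi>(uh; uh)\<close> is infinite, the gap is
  \<open>-\<infinity>\<close> because \<open>\<Phi>(a + b; uh)\<close> is finite by the line search condition.
\<close>

lemma gap_estimate_of_line_search:
  fixes F E :: "'x::{real_inner,complete_space} \<Rightarrow> ereal"
    and G :: "'y::{real_inner,complete_space} \<Rightarrow> ereal"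
    and a b u uh :: "'x \<times> 'y"
  assumes st: "pd_structure F E G K L \<tau> \<sigma>" and \<epsilon>: "\<epsilon> > 0"
    and step: "- (gradient (Ebar E) u + Xi_op K a + M_op \<tau> \<sigma> K (a - u)) \<in> subdiff (Gbar F G) a"
    and search: "Phi F E G K (a + b) a + ereal (1 / 2 * (opnorm (M_op \<tau> \<sigma> K) b)\<^sup>2)
         + ereal (1 / (2 * \<epsilon>) * (opnorm (W_op \<tau> \<sigma> K) b)\<^sup>2)
       \<le> Phi F E G K a a + ereal (\<rho> / 2)"
  shows "lagrangian_gap F E G K (a + b) uh
           + ereal (1 / 2 * (opnorm (M_op \<tau> \<sigma> K) (a + b - uh))\<^sup>2)
           + ereal (1 / 2 * (opnorm (\<lambda>u. M_op \<tau> \<sigma> K u - Lambda_op L u) (a - u))\<^sup>2)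
         \<le> ereal (1 / 2 * (opnorm (M_op \<tau> \<sigma> K) (u - uh))\<^sup>2)
           + ereal (\<epsilon> / 2 * (opnorm (M_op \<tau> \<sigma> K) (a - uh))\<^sup>2)
           + ereal (\<rho> / 2)"
proof -
  note st' = pd_structureD[OF st]
  note norms = opnorm_M[OF st'(6,7,10)] opnorm_M_minus_Lambda[OF st'(6,7,8)]
  let ?J = "objective F E G"
  let ?q = "\<lambda>u. M_op \<tau> \<sigma> K u \<bullet> u"
  have afin: "\<bar>Gbar F G a\<bar> \<noteq> \<infinity>" using step by (simp add: subdiff_def)
  have Pa: "Phi F E G K a w = ereal (?J a + Xi_op K w \<bullet> a)" for w
    by (cases rule: Phi_cases[OF st, of a]) (use afin in auto)
  have Pab: "Phi F E G K (a + b) w = ereal (?J (a + b) + Xi_op K w \<bullet> (a + b))" for w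
  proof (cases rule: Phi_cases[OF st, of "a + b"])
    case 1 with search Pa show ?thesis by simp
  qed auto
  have search': "?J (a + b) + Xi_op K a \<bullet> (a + b) + 1/2 * ?q b + 1 / (2 * \<epsilon>) * (W_op \<tau> \<sigma> K b \<bullet> b)
      \<le> ?J a + \<rho> / 2"
    using search by (simp add: Pa Pab norms Xi_inner_self)
  show ?thesis
  proof (cases rule: Phi_cases[OF st, of uh])
    case 1
    thus ?thesis by (simp add: lagrangian_gap_def Pab)
  next
    case 2
    have "?J a + Xi_op K a \<bullet> (a - uh) + 1/2 * ?q (a - uh) + 1/2 * (?q (a - u) - L * (norm (fst (a - u)))\<^sup>2)
      \<le> ?J uh + 1/2 * ?q (u - uh)"
      by (rule pd_step_inequality[OF st step 2(1)])
    moreover have "Xi_op K a \<bullet> (a - uh) = Xi_op K uh \<bullet> a"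
      using Xi_inner_commute[of K a uh] by (simp add: inner_diff_right Xi_inner_self)
    moreover have "Z_op \<tau> \<sigma> K (a - uh) \<bullet> b
        \<le> \<epsilon> / 2 * ?q (a - uh) + 1 / (2 * \<epsilon>) * (W_op \<tau> \<sigma> K b \<bullet> b)"
      by (rule Z_young[OF st'(6,7,10) \<epsilon>])
    moreover have "Z_op \<tau> \<sigma> K (a - uh) \<bullet> b = M_op \<tau> \<sigma> K (a - uh) \<bullet> b - Xi_op K a \<bullet> b + Xi_op K uh \<bullet> b"
      by (simp add: Z_eq_M_minus_Xi inner_diff_left Xi_inner_diff)
    moreover have "Xi_op K a \<bullet> (a + b) = Xi_op K a \<bullet> b" "Xi_op K uh \<bullet> (a + b) = Xi_op K uh \<bullet> a + Xi_op K uh \<bullet> b"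
      by (simp_all add: inner_add_right Xi_inner_self)
    moreover have "?q (a + b - uh) = ?q (a - uh) + 2 * (M_op \<tau> \<sigma> K (a - uh) \<bullet> b) + ?q b"
    proof -
      have "a + b - uh = (a - uh) + b" by simp
      thus ?thesis using M_inner_commute[of \<tau> \<sigma> K b "a - uh"]
        by (simp only: M_inner_add inner_add_right)
    qed
    ultimately have "?J (a + b) + Xi_op K uh \<bullet> (a + b) - ?J uh + 1/2 * ?q (a + b - uh)
        + 1/2 * (?q (a - u) - L * (norm (fst (a - u)))\<^sup>2)
      \<le> 1/2 * ?q (u - uh) + \<epsilon> / 2 * ?q (a - uh) + \<rho> / 2"
      using search' by argo
    thus ?thesis by (simp add: lagrangian_gap_def Pab 2(2) Xi_inner_self norms)
  qed
qed

section \<open>The main estimate\<close>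

theorem theorem5p4:
  fixes F E :: "'x::{real_inner,complete_space} \<Rightarrow> ereal"
    and G :: "'y::{real_inner,complete_space} \<Rightarrow> ereal"
    and K :: "'x \<Rightarrow>\<^sub>L 'y"
    and L \<tau> \<sigma> :: real
    and F\<^sub>H :: "'xh::{real_inner,complete_space} \<Rightarrow> ereal"
    and E\<^sub>H :: "'xh \<Rightarrow> real"
    and G\<^sub>H :: "'yh::{real_inner,complete_space} \<Rightarrow> ereal"
    and K\<^sub>H :: "'xh \<Rightarrow>\<^sub>L 'yh"
    and L\<^sub>H \<tau>\<^sub>H \<sigma>\<^sub>H :: real
    and P :: "'x \<Rightarrow>\<^sub>L 'xh" and D :: "'y \<Rightarrow>\<^sub>L 'yh"
    and x x\<^sub>p :: 'x and y y\<^sub>p :: 'y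
    and u\<^sub>k u\<^sub>p d :: "'x \<times> 'y"
    and v :: "nat \<Rightarrow> 'xh \<times> 'yh" and vt s w :: "'xh \<times> 'yh"
    and m :: nat and vtheta \<kappa> \<epsilon> \<rho> \<theta> :: real
  assumes fine: "pd_structure F E G K L \<tau> \<sigma>"
    and coarse: "pd_structure F\<^sub>H (\<lambda>\<zeta>. ereal (E\<^sub>H \<zeta>)) G\<^sub>H K\<^sub>H L\<^sub>H \<tau>\<^sub>H \<sigma>\<^sub>H"
    and u\<^sub>k: "u\<^sub>k = (x, y)"
    and x\<^sub>p: "x\<^sub>p = prox (\<lambda>z. ereal \<tau> * F z)
                     (x - \<tau> *\<^sub>R (gradient E x + adjoint (blinfun_apply K) y))"
    and y\<^sub>p: "y\<^sub>p = prox (\<lambda>z. ereal \<sigma> * conjugate G z)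
                     (y + \<sigma> *\<^sub>R blinfun_apply K (2 *\<^sub>R x\<^sub>p - x))"
    and u\<^sub>p: "u\<^sub>p = (x\<^sub>p, y\<^sub>p)"
    and v0: "v 0 = restrict_op P D u\<^sub>p"
    and coherence: "restrict_op P D ` subdiff (Gbar F G) u\<^sub>p \<subseteq> subdiff (Gbar F\<^sub>H G\<^sub>H) (v 0)"
    and s: "s = restrict_op P D (gradient (Ebar E) u\<^sub>p + Xi_op K u\<^sub>p)
                - gradient (Ebar (\<lambda>\<zeta>. ereal (E\<^sub>H \<zeta>))) (v 0)"
    and w: "w = s - Xi_op K\<^sub>H (v 0)"
    and not_solution: "\<not> solves_coarse F\<^sub>H (\<lambda>\<zeta>. ereal (E\<^sub>H \<zeta>)) G\<^sub>H K\<^sub>H w (v 0)"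
    and m: "m \<ge> 1"
    and vtheta: "vtheta \<in> {0, 1}"
    and coarse_steps: "\<And>j. j < m \<Longrightarrow>
          0 \<in> (\<lambda>p. p + Xi_op K\<^sub>H (v (Suc j) - ((1 - vtheta) *\<^sub>R v j + vtheta *\<^sub>R v 0))
                     + gradient (Ebar (\<lambda>\<zeta>. ereal (E\<^sub>H \<zeta>))) (v j) + s
                     + M_op \<tau>\<^sub>H \<sigma>\<^sub>H K\<^sub>H (v (Suc j) - v j))
               ` subdiff (Gbar F\<^sub>H G\<^sub>H) (v (Suc j))"
    and vt: "vt = (if vtheta = 1 then (1 / real m) *\<^sub>R (\<Sum>j<m. v (Suc j)) else v m)"
    and d: "d = adjoint (restrict_op P D) (vt - v 0)"
    and \<kappa>: "0 < \<kappa>" "\<kappa> < 1"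
    and pos: "\<epsilon> > 0" "\<rho> > 0" "\<theta> > 0"
    and max_formula: "dirderiv (\<lambda>u. Phi F E G K u u\<^sub>p) u\<^sub>p d
          = (SUP p \<in> subdiff (\<lambda>u. Phi F E G K u u\<^sub>p) u\<^sub>p. ereal (p \<bullet> d))"
    and line_search:
      "Phi F E G K (u\<^sub>p + \<theta> *\<^sub>R d) u\<^sub>p
         + ereal (1 / 2 * (opnorm (M_op \<tau> \<sigma> K) (\<theta> *\<^sub>R d))\<^sup>2)
         + ereal (1 / (2 * \<epsilon>) * (opnorm (W_op \<tau> \<sigma> K) (\<theta> *\<^sub>R d))\<^sup>2)
       \<le> Phi F E G K u\<^sub>p u\<^sub>p
         + ereal (\<kappa> * \<theta>) * dirderiv (\<lambda>u. Phi F E G K u u\<^sub>p) u\<^sub>p d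
         + ereal (\<rho> / 2)"
  shows "\<forall>uh. lagrangian_gap F E G K (u\<^sub>p + \<theta> *\<^sub>R d) uh
           + ereal (1 / 2 * (opnorm (M_op \<tau> \<sigma> K) (u\<^sub>p + \<theta> *\<^sub>R d - uh))\<^sup>2)
           + ereal (1 / 2 * (opnorm (\<lambda>u. M_op \<tau> \<sigma> K u - Lambda_op L u) (u\<^sub>p - u\<^sub>k))\<^sup>2)
         \<le> ereal (1 / 2 * (opnorm (M_op \<tau> \<sigma> K) (u\<^sub>k - uh))\<^sup>2)
           + ereal (\<epsilon> / 2 * (opnorm (M_op \<tau> \<sigma> K) (u\<^sub>p - uh))\<^sup>2)
           + ereal (\<rho> / 2)"
proof
  fix uh
  have step: "- (gradient (Ebar E) u\<^sub>k + Xi_op K u\<^sub>p + M_op \<tau> \<sigma> K (u\<^sub>p - u\<^sub>k)) \<in> subdiff (Gbar F G) u\<^sub>p"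
    unfolding u\<^sub>k u\<^sub>p by (rule fine_step_inclusion[OF fine x\<^sub>p y\<^sub>p])
  have steps: "- (Xi_op K\<^sub>H (v (Suc j) - ((1 - vtheta) *\<^sub>R v j + vtheta *\<^sub>R v 0))
      + gradient (Ebar (\<lambda>\<zeta>. ereal (E\<^sub>H \<zeta>))) (v j) + s + M_op \<tau>\<^sub>H \<sigma>\<^sub>H K\<^sub>H (v (Suc j) - v j))
      \<in> subdiff (Gbar F\<^sub>H G\<^sub>H) (v (Suc j))" if j: "j < m" for j
  proof -
    obtain p where p: "p \<in> subdiff (Gbar F\<^sub>H G\<^sub>H) (v (Suc j))"
      and 0: "0 = p + Xi_op K\<^sub>H (v (Suc j) - ((1 - vtheta) *\<^sub>R v j + vtheta *\<^sub>R v 0))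
        + gradient (Ebar (\<lambda>\<zeta>. ereal (E\<^sub>H \<zeta>))) (v j) + s + M_op \<tau>\<^sub>H \<sigma>\<^sub>H K\<^sub>H (v (Suc j) - v j)"
      using coarse_steps[OF j] by (elim imageE)
    have "p = - (Xi_op K\<^sub>H (v (Suc j) - ((1 - vtheta) *\<^sub>R v j + vtheta *\<^sub>R v 0))
        + gradient (Ebar (\<lambda>\<zeta>. ereal (E\<^sub>H \<zeta>))) (v j) + s + M_op \<tau>\<^sub>H \<sigma>\<^sub>H K\<^sub>H (v (Suc j) - v j))"
      using 0 by (simp only: eq_neg_iff_add_eq_0 add.assoc)
    with p show ?thesis by (simp only:)
  qed
  have slope: "dirderiv (\<lambda>u. Phi F E G K u u\<^sub>p) u\<^sub>p d \<le> 0"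
    unfolding max_formula
  proof (rule SUP_least)
    fix p assume p: "p \<in> subdiff (\<lambda>u. Phi F E G K u u\<^sub>p) u\<^sub>p"
    define g where "g = gradient (Ebar E) u\<^sub>p + Xi_op K u\<^sub>p"
    have "p - g \<in> subdiff (Gbar F G) u\<^sub>p"
      unfolding g_def by (rule subdiff_Phi_imp_Gbar[OF fine p])
    hence q: "restrict_op P D (p - g) \<in> subdiff (Gbar F\<^sub>H G\<^sub>H) (v 0)" using coherence by blast
    \<comment> \<open>the shift \<open>s\<close> replaces the coarse gradient at \<open>v 0\<close> by the restricted fine one\<close>
    have "restrict_op P D p
      = restrict_op P D (p - g) + gradient (Ebar (\<lambda>\<zeta>. ereal (E\<^sub>H \<zeta>))) (v 0) + s"
      using restrict_add[of P D "p - g" g] unfolding s g_def[symmetric] by simp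
    hence "p \<bullet> d
      = (restrict_op P D (p - g) + gradient (Ebar (\<lambda>\<zeta>. ereal (E\<^sub>H \<zeta>))) (v 0) + s) \<bullet> (vt - v 0)"
      unfolding d by (simp add: adjoint_restrict_inner)
    also have "\<dots> \<le> 0"
      by (rule coarse_direction_nonascent[OF coarse q m vtheta steps vt])
    finally show "ereal (p \<bullet> d) \<le> 0" by simp
  qed
  have "ereal (\<kappa> * \<theta>) * dirderiv (\<lambda>u. Phi F E G K u u\<^sub>p) u\<^sub>p d \<le> ereal (\<kappa> * \<theta>) * 0"
    using slope \<kappa> pos by (intro ereal_mult_left_mono) auto
  hence "Phi F E G K u\<^sub>p u\<^sub>p + ereal (\<kappa> * \<theta>) * dirderiv (\<lambda>u. Phi F E G K u u\<^sub>p) u\<^sub>p d + ereal (\<rho> / 2)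
      \<le> Phi F E G K u\<^sub>p u\<^sub>p + 0 + ereal (\<rho> / 2)"
    by (intro add_mono) auto
  from order_trans[OF line_search this]
  have "Phi F E G K (u\<^sub>p + \<theta> *\<^sub>R d) u\<^sub>p + ereal (1 / 2 * (opnorm (M_op \<tau> \<sigma> K) (\<theta> *\<^sub>R d))\<^sup>2)
      + ereal (1 / (2 * \<epsilon>) * (opnorm (W_op \<tau> \<sigma> K) (\<theta> *\<^sub>R d))\<^sup>2)
    \<le> Phi F E G K u\<^sub>p u\<^sub>p + ereal (\<rho> / 2)"
    by (simp only: add_0_right)
  thus "lagrangian_gap F E G K (u\<^sub>p + \<theta> *\<^sub>R d) uh
           + ereal (1 / 2 * (opnorm (M_op \<tau> \<sigma> K) (u\<^sub>p + \<theta> *\<^sub>R d - uh))\<^sup>2)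
           + ereal (1 / 2 * (opnorm (\<lambda>u. M_op \<tau> \<sigma> K u - Lambda_op L u) (u\<^sub>p - u\<^sub>k))\<^sup>2)
         \<le> ereal (1 / 2 * (opnorm (M_op \<tau> \<sigma> K) (u\<^sub>k - uh))\<^sup>2)
           + ereal (\<epsilon> / 2 * (opnorm (M_op \<tau> \<sigma> K) (u\<^sub>p - uh))\<^sup>2)
           + ereal (\<rho> / 2)"
    by (rule gap_estimate_of_line_search[OF fine pos(1) step])
qed

end
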